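(* Let $z$ be a simple predictable process $z(w,t)=\sum_{k=1}^{2^s}2^{s/2}z_k(w)\,1_{(\frac{k-1}{2^s},\frac k{2^s}]}(t)$, where each $z_k$ is an $\mathcal{F}_{(k-1)/2^s}$-measurable random variable. (i) For any $F\in\mathbf{P}_H$, $$e^{D_{z_{2^s}}}\cdots e^{D_{z_1}}F(w)=F\Big(w+\int_0^{\cdot}z(w,u)\,du\Big).$$ (ii) For any $k\in\{1,\dots,2^s\}$ and any $\mathcal{F}_{(k-1)/2^s}$-measurable random variable $F$, $$e^{D_{z_k}^{*}}F=F\,e^{D_{z_k}^{*}}(1);$$ in particular $F$ is in the domain of $e^{D_{z_k}^{*}}$. Furthermore, $$e^{D_{z_{2^s}}^{*}}\cdots e^{D_{z_1}^{*}}(1)=\exp\Big\{\int_0^1z(w,t)\,dw(t)-\frac12\int_0^1z(w,t)^2\,dt\Big\}.$$ (iii) Fix $k\in\{1,\dots,2^s\}$. Let $F\in\mathbf{P}$ and let $G$ be an arbitrary $\mathcal{F}_{(k-1)/2^s}$-measurable integrable function. Then $$E\big[e^{D_{z_k}}(F)\,G\big]=E\big[F\,e^{D_{z_k}^{*}}(G)\big].$$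
   Context: $(\mathscr{W},\mathscr{B}(\mathscr{W}),\gamma)$ is the Wiener space: $\mathscr{W}$ is the set of continuous paths $w:[0,1]\to\mathbb{R}$ with $w(0)=0$, with the $\sigma$-field generated by the topology of uniform convergence, and $\gamma$ is Wiener measure; $E$ is expectation under $\gamma$, and $\{\mathcal{F}_t\}_{0\le t\le1}$ is the natural filtration of $\mathscr{W}$ (generated by the coordinate process $w(t)$). $\mathscr{H}\subset\mathscr{W}$ is the Cameron-Martin space of absolutely continuous $h$ with square-integrable derivative $\dot h$, with inner product $\langle h_1,h_2\rangle_{\mathscr{H}}=\int_0^1\dot h_1(t)\dot h_2(t)\,dt$. For $h\in\mathscr{H}$, $[h](w):=\int_0^1\dot h(t)\,dw(t)$ (Wiener integral); translations by $\mathscr{H}$-valued (possibly random) elements $Z$ are understood via $[h](w+Z(w))=[h](w)+\langle h,Z(w)\rangle_{\mathscr{H}}$. $\mathbf{P}$ is the algebra of polynomial functionals $F(w)=p([h_1](w),\dots,[h_n](w))$, with $n\in\mathbb{N}$, $h_i\in\mathscr{H}$, $p$ a real polynomial in $n$ variables. For $\theta\in\mathscr{H}$, $D_\theta F(w)=\lim_{\varepsilon\to0}\frac1\varepsilon\{F(w+\varepsilon\theta)-F(w)\}$ whenever it exists, and $D_\theta^{*}F:=-D_\theta F+[\theta]F$. For $s\in\mathbb{N}$ and $k=1,\dots,2^s$, $\sigma_k(t)=\sigma_k^s(t):=2^{s/2}\int_0^t1_{(\frac{k-1}{2^s},\frac k{2^s}]}(u)\,du\in\mathscr{H}$; one has $D_{\sigma_k}F=0$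 for every $\mathcal{F}_{(k-1)/2^s}$-measurable $F$. $\mathbf{P}_H\subset\mathbf{P}$ is the subspace of polynomials in $\{[e_i]\}$, where $\{e_i\}$ is the Haar system; equivalently, all polynomials in $\{[\sigma_k^s]:k=1,\dots,2^s,\ s\in\mathbb{N}\}$. Put $D_{z_k}:=z_kD_{\sigma_k}$ and $D_{z_k}^{*}:=z_kD_{\sigma_k}^{*}$ (the operators followed by multiplication by $z_k$), and define formally $e^{D_{z_k}}:=\sum_{n\ge0}\frac1{n!}D_{z_k}^n$, $e^{D_{z_k}^{*}}:=\sum_{n\ge0}\frac1{n!}(D_{z_k}^{*})^n$ (sums taken pointwise). *)

theory Defs
  imports "HOL-Probability.Probability"
begin

section \<open>Path space\<close>

text \<open>A path on the interval from 0 to 1 starting at 0 is extended to the real line by 0 on the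
  left and by its final value on the right.  The paths then form a closed linear subspace of the
  Banach space of bounded continuous functions, the sup norms agree, and the Borel sets of the
  subspace are those of the topology of uniform convergence.\<close>

type_synonym path = "(real, real) bcontfun"

definition paths :: "path set" where
  "paths = {w. (\<forall>t\<le>0. apply_bcontfun w t = 0) \<and> (\<forall>t\<ge>1. apply_bcontfun w t = apply_bcontfun w 1)}"

text \<open>\<open>partition m t\<close>: the points \<open>t 0 \<le> \<dots> \<le> t m\<close> lie between 0 and 1.\<close>

definition partition :: "nat \<Rightarrow> (nat \<Rightarrow> real) \<Rightarrow> bool" where
  "partition m t \<longleftrightarrow> 0 \<le> t 0 \<and> (\<forall>i<m. t i \<le> t (Suc i)) \<and> t m \<le> 1"

definition wiener_measure :: "path measure \<Rightarrow> bool" where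
  "wiener_measure \<gamma> \<longleftrightarrow>
     prob_space \<gamma> \<and>
     sets \<gamma> = sets (restrict_space borel paths) \<and>
     (\<forall>u v. 0 \<le> u \<and> u < v \<and> v \<le> 1 \<longrightarrow>
        distributed \<gamma> lborel (\<lambda>w. apply_bcontfun w v - apply_bcontfun w u)
          (\<lambda>x. ennreal (normal_density 0 (sqrt (v - u)) x))) \<and>
     (\<forall>m t. partition m t \<longrightarrow>
        prob_space.indep_vars \<gamma> (\<lambda>_. borel)
          (\<lambda>i w. apply_bcontfun w (t (Suc i)) - apply_bcontfun w (t i)) {..<m})"

text \<open>The natural filtration, not augmented by null sets.\<close>

definition nat_filtration :: "real \<Rightarrow> path measure" where
  "nat_filtration t = sigma paths
     {(\<lambda>w. apply_bcontfun w u) -` B \<inter> paths | u B. 0 \<le> u \<and> u \<le> t \<and> u \<le> 1 \<and> B \<in> sets borel}"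

section \<open>Cameron-Martin space\<close>

definition abs_cont01 :: "(real \<Rightarrow> real) \<Rightarrow> bool" where
  "abs_cont01 f \<longleftrightarrow>
     (\<forall>\<epsilon>>0. \<exists>\<delta>>0. \<forall>(n::nat) a b.
        (\<forall>i<n. 0 \<le> a i \<and> a i \<le> b i \<and> b i \<le> 1) \<longrightarrow>
        (\<forall>i<n. \<forall>j<n. i \<noteq> j \<longrightarrow> {a i<..<b i} \<inter> {a j<..<b j} = {}) \<longrightarrow>
        (\<Sum>i<n. b i - a i) < \<delta> \<longrightarrow>
        (\<Sum>i<n. \<bar>f (b i) - f (a i)\<bar>) < \<epsilon>)"

text \<open>For absolutely continuous \<open>h\<close> differentiability almost everywhere and measurability of the
  derivative are automatic; they are listed so that \<open>deriv\<close> is visibly meaningful.\<close>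

definition cameron_martin :: "path set" where
  "cameron_martin = {h \<in> paths.
     abs_cont01 (apply_bcontfun h) \<and>
     (AE t in lborel. t \<in> {0<..<1} \<longrightarrow> apply_bcontfun h field_differentiable (at t)) \<and>
     set_borel_measurable lborel {0..1} (deriv (apply_bcontfun h)) \<and>
     set_integrable lborel {0..1} (\<lambda>t. (deriv (apply_bcontfun h) t)\<^sup>2)}"

definition cm_inner :: "path \<Rightarrow> path \<Rightarrow> real" where
  "cm_inner h g =
     (LBINT t:{0..1}. deriv (apply_bcontfun h) t * deriv (apply_bcontfun g) t)"

text \<open>The path \<open>t \<mapsto> \<integral>\<^sub>0\<^sup>t f(u) du\<close>.  For \<open>t < 0\<close> the interval of integration is empty.\<close>

definition primitive :: "(real \<Rightarrow> real) \<Rightarrow> path" where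
  "primitive f = Bcontfun (\<lambda>t. LBINT u:{0..min 1 t}. f u)"

lemma apply_primitive:
  assumes "set_integrable lborel {0..1} f"
  shows "apply_bcontfun (primitive f) t = (LBINT u:{0..min 1 t}. f u)"
proof -
  let ?g = "\<lambda>t. LBINT u:{0..min 1 t}. f u"
  define c where "c = (\<lambda>t::real. max 0 (min 1 t))"
  have int: "f integrable_on {0..1}"
    using set_borel_integral_eq_integral(1)[OF assms] .
  have cont: "continuous_on {0..1} (\<lambda>x. integral {0..x} f)"
    by (rule indefinite_integral_continuous_1[OF int])
  have eq: "?g t = integral {0..c t} f" for t
  proof (cases "t < 0")
    case True
    then show ?thesis by (simp add: c_def set_lebesgue_integral_def)
  next
    case False
    have "set_integrable lborel {0..min 1 t} f"
      by (rule set_integrable_subset[OF assms]) auto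
    from set_borel_integral_eq_integral(2)[OF this] False show ?thesis
      by (simp add: c_def)
  qed
  have "continuous_on UNIV (\<lambda>t. integral {0..c t} f)"
    by (rule continuous_on_compose2[OF cont, of UNIV c])
      (auto simp: c_def intro!: continuous_intros)
  moreover have "bounded (range (\<lambda>t. integral {0..c t} f))"
  proof -
    have "compact ((\<lambda>x. integral {0..x} f) ` {0..1})"
      by (rule compact_continuous_image[OF cont]) simp
    moreover have "range (\<lambda>t. integral {0..c t} f) \<subseteq> (\<lambda>x. integral {0..x} f) ` {0..1}"
      by (auto simp: c_def)
    ultimately show ?thesis
      using bounded_subset compact_imp_bounded by blast
  qed
  ultimately have "?g \<in> bcontfun"
    unfolding eq bcontfun_def by simp
  then show ?thesis
    by (simp add: primitive_def Bcontfun_inverse)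
qed

lemma primitive_in_paths:
  assumes "set_integrable lborel {0..1} f"
  shows "primitive f \<in> paths"
proof -
  have "(LBINT u:{0..t}. f u) = 0" if "t \<le> 0" for t
  proof (cases "t = 0")
    case True
    then show ?thesis
      using set_borel_integral_eq_integral(2)[OF set_integrable_subset[OF assms, of "{0..0}"]]
      by simp
  next
    case False
    with that show ?thesis by (simp add: set_lebesgue_integral_def)
  qed
  then show ?thesis
    unfolding paths_def by (auto simp: apply_primitive[OF assms] min_def)
qed

section \<open>Wiener integral\<close>

definition step_fun :: "nat \<Rightarrow> (nat \<Rightarrow> real) \<Rightarrow> (nat \<Rightarrow> real) \<Rightarrow> real \<Rightarrow> real" where
  "step_fun m c t u = (\<Sum>i<m. c i * indicator {t i<..t (Suc i)} u)"

definition step_integral :: "nat \<Rightarrow> (nat \<Rightarrow> real) \<Rightarrow> (nat \<Rightarrow> real) \<Rightarrow> path \<Rightarrow> real" where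
  "step_integral m c t w = (\<Sum>i<m. c i * (apply_bcontfun w (t (Suc i)) - apply_bcontfun w (t i)))"

text \<open>\<open>is_wiener_integral \<gamma> h X\<close>: the random variable \<open>X\<close> is a version of the Wiener integral of the
  derivative of \<open>h\<close>, i.e. the mean square limit of the elementary integrals of step functions
  approximating that derivative in mean square.\<close>

definition is_wiener_integral :: "path measure \<Rightarrow> path \<Rightarrow> (path \<Rightarrow> real) \<Rightarrow> bool" where
  "is_wiener_integral \<gamma> h X \<longleftrightarrow>
     X \<in> borel_measurable (completion \<gamma>) \<and>
     (\<exists>m c t. (\<forall>n::nat. partition (m n) (t n)) \<and>
        (\<lambda>n. \<integral>\<^sup>+u. ennreal ((step_fun (m n) (c n) (t n) u - deriv (apply_bcontfun h) u)\<^sup>2)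
               * indicator {0..1} u \<partial>lborel) \<longlonglongrightarrow> 0 \<and>
        (\<lambda>n. \<integral>\<^sup>+w. ennreal ((step_integral (m n) (c n) (t n) w - X w)\<^sup>2) \<partial>completion \<gamma>)
          \<longlonglongrightarrow> 0)"

text \<open>\<open>wiener_integrals \<gamma> I\<close>: \<open>I h\<close> is a choice of a version of the Wiener integral \<open>[h]\<close> for each
  \<open>h\<close> in the Cameron-Martin space, subject to two conventions.
  If \<open>h\<close> is the primitive of a step function, \<open>[h]\<close> is the elementary integral at every path.
  In general the translation rule \<open>[h](w + \<theta>) = [h](w) + \<langle>h, \<theta>\<rangle>\<close> holds simultaneously for all
  \<open>\<theta>\<close> at almost every \<open>w\<close>.  It cannot be asked for at every \<open>w\<close>, since for general \<open>h\<close> no Borel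
  version has that property.  Such a choice exists: the derivative of \<open>h\<close> may be averaged over
  dyadic intervals, and \<open>I h w\<close> is then the limit of the elementary integrals of these averages
  where the limit exists, and 0 elsewhere.\<close>

definition wiener_integrals :: "path measure \<Rightarrow> (path \<Rightarrow> path \<Rightarrow> real) \<Rightarrow> bool" where
  "wiener_integrals \<gamma> I \<longleftrightarrow>
     (\<forall>h\<in>cameron_martin. is_wiener_integral \<gamma> h (I h)) \<and>
     (\<forall>m c t. partition m t \<longrightarrow>
        (\<forall>w\<in>paths. I (primitive (step_fun m c t)) w = step_integral m c t w)) \<and>
     (\<forall>h\<in>cameron_martin. AE w in \<gamma>. \<forall>\<theta>\<in>cameron_martin. I h (w + \<theta>) = I h w + cm_inner h \<theta>)"

section \<open>Polynomial functionals\<close>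

text \<open>A real polynomial in \<open>n\<close> variables is given by a finite set \<open>A\<close> of multi-indices and
  coefficients \<open>c\<close>.\<close>

definition poly_functionals :: "(path \<Rightarrow> path \<Rightarrow> real) \<Rightarrow> path set \<Rightarrow> (path \<Rightarrow> real) set" where
  "poly_functionals I K = {F. \<exists>(n::nat) h (A :: (nat \<Rightarrow> nat) set) c.
     (\<forall>i<n. h i \<in> K) \<and> finite A \<and>
     (\<forall>w\<in>paths. F w = (\<Sum>\<alpha>\<in>A. c \<alpha> * (\<Prod>i<n. I (h i) w ^ \<alpha> i)))}"

definition sigma_path :: "nat \<Rightarrow> nat \<Rightarrow> path" where
  "sigma_path s k = primitive (\<lambda>u. 2 powr (real s / 2) * indicator {(real k - 1) / 2^s<..real k / 2^s} u)"

abbreviation polyP :: "(path \<Rightarrow> path \<Rightarrow> real) \<Rightarrow> (path \<Rightarrow> real) set" where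
  "polyP I \<equiv> poly_functionals I cameron_martin"

abbreviation polyPH :: "(path \<Rightarrow> path \<Rightarrow> real) \<Rightarrow> (path \<Rightarrow> real) set" where
  "polyPH I \<equiv> poly_functionals I {sigma_path s k | s k. k \<in> {1..2^s}}"

section \<open>Derivatives and exponentials\<close>

definition has_D :: "path \<Rightarrow> (path \<Rightarrow> real) \<Rightarrow> path \<Rightarrow> real \<Rightarrow> bool" where
  "has_D \<theta> F w L \<longleftrightarrow> ((\<lambda>\<epsilon>. (F (w + \<epsilon> *\<^sub>R \<theta>) - F w) / \<epsilon>) \<longlongrightarrow> L) (at 0)"

definition D :: "path \<Rightarrow> (path \<Rightarrow> real) \<Rightarrow> path \<Rightarrow> real" where
  "D \<theta> F w = (THE L. has_D \<theta> F w L)"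

definition D_star :: "(path \<Rightarrow> path \<Rightarrow> real) \<Rightarrow> path \<Rightarrow> (path \<Rightarrow> real) \<Rightarrow> path \<Rightarrow> real" where
  "D_star I \<theta> F w = - D \<theta> F w + I \<theta> w * F w"

definition Dz :: "nat \<Rightarrow> (nat \<Rightarrow> path \<Rightarrow> real) \<Rightarrow> nat \<Rightarrow> (path \<Rightarrow> real) \<Rightarrow> path \<Rightarrow> real" where
  "Dz s z k F w = z k w * D (sigma_path s k) F w"

definition Dz_star ::
    "(path \<Rightarrow> path \<Rightarrow> real) \<Rightarrow> nat \<Rightarrow> (nat \<Rightarrow> path \<Rightarrow> real) \<Rightarrow> nat \<Rightarrow> (path \<Rightarrow> real) \<Rightarrow> path \<Rightarrow> real" where
  "Dz_star I s z k F w = z k w * D_star I (sigma_path s k) F w"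

definition exp_op :: "((path \<Rightarrow> real) \<Rightarrow> path \<Rightarrow> real) \<Rightarrow> (path \<Rightarrow> real) \<Rightarrow> path \<Rightarrow> real" where
  "exp_op A F w = (\<Sum>n. (A ^^ n) F w / fact n)"

text \<open>\<open>exp_defined \<theta> A F w\<close>, for an operator \<open>A\<close> built from \<open>D \<theta>\<close>: the value of \<open>exp_op A F\<close> at
  \<open>w\<close> is genuine.  The derivative of each iterate exists along the whole line through \<open>w\<close> in
  direction \<open>\<theta>\<close>, so that no unspecified value of \<open>D\<close> enters an iterated derivative at \<open>w\<close>, and
  the exponential series converges.\<close>

definition exp_defined ::
    "path \<Rightarrow> ((path \<Rightarrow> real) \<Rightarrow> path \<Rightarrow> real) \<Rightarrow> (path \<Rightarrow> real) \<Rightarrow> path \<Rightarrow> bool" where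
  "exp_defined \<theta> A F w \<longleftrightarrow>
     (\<forall>n (\<epsilon>::real). \<exists>L. has_D \<theta> ((A ^^ n) F) (w + \<epsilon> *\<^sub>R \<theta>) L) \<and>
     summable (\<lambda>n. (A ^^ n) F w / fact n)"

text \<open>\<open>exp_chain A k F\<close> is \<open>e\<^bsup>A k\<^esup> \<dots> e\<^bsup>A 1\<^esup> F\<close>; the operator with index 1 acts first.\<close>

fun exp_chain ::
    "(nat \<Rightarrow> (path \<Rightarrow> real) \<Rightarrow> path \<Rightarrow> real) \<Rightarrow> nat \<Rightarrow> (path \<Rightarrow> real) \<Rightarrow> path \<Rightarrow> real" where
  "exp_chain A 0 F = F"
| "exp_chain A (Suc k) F = exp_op (A (Suc k)) (exp_chain A k F)"

section \<open>Simple predictable processes\<close>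

definition simple_process :: "nat \<Rightarrow> (nat \<Rightarrow> path \<Rightarrow> real) \<Rightarrow> path \<Rightarrow> real \<Rightarrow> real" where
  "simple_process s z w t =
     (\<Sum>k=1..2^s. 2 powr (real s / 2) * z k w * indicator {(real k - 1) / 2^s<..real k / 2^s} t)"

text \<open>The stochastic integral of \<open>simple_process s z\<close> over the unit interval.\<close>

definition simple_ito :: "nat \<Rightarrow> (nat \<Rightarrow> path \<Rightarrow> real) \<Rightarrow> path \<Rightarrow> real" where
  "simple_ito s z w =
     (\<Sum>k=1..2^s. 2 powr (real s / 2) * z k w *
        (apply_bcontfun w (real k / 2^s) - apply_bcontfun w ((real k - 1) / 2^s)))"

end

theory Submission
  imports Defs
begin

text \<open>On a line in direction \<open>\<sigma>\<^sub>k\<close> a functional of the paths becomes a function of one real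
  variable and \<open>z\<^sub>k\<close> is constant, because \<open>\<sigma>\<^sub>k\<close> vanishes up to the time that determines \<open>z\<^sub>k\<close>.  Hence
  \<open>e\<^bsup>D\<^esup>\<close> is Taylor's formula for a polynomial.  The iterates of the adjoint on a constant are Hermite
  polynomials in \<open>[\<sigma>\<^sub>k]\<close>, and \<open>e\<^bsup>D*\<^esup>\<close> is their generating function.

  For the duality write \<open>w = T w + X w \<sigma>\<^sub>k\<close> with \<open>X = [\<sigma>\<^sub>k]\<close>.  The Cameron-Martin formula for shifts
  along \<open>\<sigma>\<^sub>k\<close> follows from the independence of the Gaussian increments, and it implies that \<open>X\<close> is
  standard normal and independent of \<open>T\<close>.  Since \<open>z\<^sub>k\<close> and \<open>G\<close> are functions of \<open>T\<close>, the shift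
  \<open>X \<mapsto> X + z\<^sub>k\<close> is a translation of a Gaussian variable by a constant.  Finally
  \<open>[h] = V\<^sub>h(T) + \<langle>h, \<sigma>\<^sub>k\<rangle> X\<close> almost surely, where \<open>V\<^sub>h\<close> is a limit of elementary integrals, so the
  shift acts on polynomial functionals as the exponential of the derivation does.\<close>

section \<open>Exponentials of derivations on a line\<close>

text \<open>Two grades of exceptional set shape the proof. In \<open>polyPH\<close> and in the
  adjoint exponentials only increments of the path occur, and since the filtration is not augmented
  an adapted variable is literally a function of the path up to its time; so the first two
  assertions hold at every path. For general \<open>F\<close> in \<open>polyP\<close> a Wiener
  integral is known only up to a null set, while the image of \<open>T\<close> lies in the null set
  where \<open>X\<close> is 0. The value of \<open>I h\<close> at \<open>T w\<close> therefore
  carries no information, and the part of \<open>[h]\<close> depending on \<open>T\<close> has to be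
  built from elementary integrals, which make sense at every path. On such an \<open>F\<close> the
  value of \<open>exp_op\<close> is only almost everywhere equal to a Borel function, hence the
  completion in the duality. Moreover \<open>z k\<close> is merely measurable, without moment
  bounds, so the duality is obtained as an identity of image measures of the pair formed by
  \<open>T\<close> and \<open>X\<close>; it transports integrability and the value of the integral
  together.\<close>

lemma D_eq:
  assumes "has_D \<theta> F w L"
  shows "D \<theta> F w = L"
  unfolding D_def
proof (rule the_equality)
  show "has_D \<theta> F w L" by fact
  show "L' = L" if "has_D \<theta> F w L'" for L'
    using tendsto_unique[OF _ that[unfolded has_D_def] assms[unfolded has_D_def]] by simp
qed

text \<open>A step \<open>h\<close> along the line only moves the parameter from
  \<open>\<epsilon>\<close> to \<open>\<epsilon> + h\<close>, so directional derivatives reduce to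
  one-variable calculus. All values of \<open>D\<close> below are computed in this way.\<close>

lemma has_D_line:
  assumes "\<And>\<epsilon>. F (w + \<epsilon> *\<^sub>R \<theta>) = f \<epsilon>" and "(f has_real_derivative d) (at \<epsilon>)"
  shows "has_D \<theta> F (w + \<epsilon> *\<^sub>R \<theta>) d"
proof -
  have "F (w + \<epsilon> *\<^sub>R \<theta> + h *\<^sub>R \<theta>) = f (\<epsilon> + h)" for h
    using assms(1)[of "\<epsilon> + h"] by (simp add: scaleR_add_left add.assoc)
  then show ?thesis
    using assms(2) by (simp add: has_D_def DERIV_def assms(1))
qed

lemma poly_taylor_sums:
  fixes p :: "real poly"
  shows "(\<lambda>n. c ^ n * poly ((pderiv ^^ n) p) 0 / fact n) sums poly p c"
proof -
  have "c ^ n * poly ((pderiv ^^ n) p) 0 / fact n = coeff p n * c ^ n" for n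
    by (simp add: poly_0_coeff_0 coeff_higher_pderiv pochhammer_fact[symmetric])
  moreover have "(\<lambda>n. coeff p n * c ^ n) sums (\<Sum>n\<le>degree p. coeff p n * c ^ n)"
    by (rule sums_finite) (auto simp: coeff_eq_0)
  ultimately show ?thesis
    by (simp add: poly_altdef)
qed

text \<open>Since \<open>\<zeta>\<close> is constant along the line, \<open>A\<close> acts there as
  \<open>c\<close> times the ordinary derivative. The induction has to run over all
  \<open>\<epsilon>\<close> at once, because the next derivative looks at neighbouring points;
  evaluation at \<open>\<epsilon> = 0\<close> then gives the Taylor series of \<open>p\<close> at 0
  with increment \<open>c\<close>.\<close>

lemma exp_derivation_on_line:
  fixes p :: "real poly"
  assumes A: "\<And>F u. A F u = \<zeta> u * D \<theta> F u"
    and \<zeta>: "\<And>\<epsilon>. \<zeta> (w + \<epsilon> *\<^sub>R \<theta>) = c"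
    and F: "\<And>\<epsilon>. F (w + \<epsilon> *\<^sub>R \<theta>) = poly p \<epsilon>"
  shows "exp_defined \<theta> A F w" and "exp_op A F w = poly p c"
proof -
  have deriv: "((\<lambda>\<epsilon>. c ^ n * poly ((pderiv ^^ n) p) \<epsilon>) has_real_derivative
      c ^ n * poly ((pderiv ^^ Suc n) p) \<epsilon>) (at \<epsilon>)" for n \<epsilon>
    by (auto intro!: derivative_eq_intros poly_DERIV)
  have iter: "(A ^^ n) F (w + \<epsilon> *\<^sub>R \<theta>) = c ^ n * poly ((pderiv ^^ n) p) \<epsilon>" for n \<epsilon>
  proof (induction n arbitrary: \<epsilon>)
    case (Suc n)
    show ?case
      using D_eq[OF has_D_line[OF Suc deriv]] by (simp add: A \<zeta>)
  qed (simp add: F)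
  have "(A ^^ n) F w = c ^ n * poly ((pderiv ^^ n) p) 0" for n
    using iter[of n 0] by simp
  then have sums: "(\<lambda>n. (A ^^ n) F w / fact n) sums poly p c"
    using poly_taylor_sums[of c p] by simp
  then show "exp_op A F w = poly p c"
    by (simp add: exp_op_def sums_iff)
  show "exp_defined \<theta> A F w"
    using has_D_line[OF iter deriv] sums by (auto simp: exp_defined_def sums_iff)
qed

text \<open>The probabilists' Hermite polynomials, given by their three-term recursion.\<close>

fun hermite :: "nat \<Rightarrow> real \<Rightarrow> real" where
  "hermite 0 x = 1"
| "hermite (Suc 0) x = x"
| "hermite (Suc (Suc n)) x = x * hermite (Suc n) x - real (Suc n) * hermite n x"

text \<open>For \<open>n = 0\<close> truncated subtraction yields \<open>hermite 0\<close>, which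
  the coefficient 0 removes; so one formula covers all \<open>n\<close>.\<close>

lemma hermite_Suc: "hermite (Suc n) x = x * hermite n x - real n * hermite (n - 1) x"
  by (cases n) auto

text \<open>Differentiating the recursion gives three terms, which the recursion one index lower
  folds back into one. With \<open>hermite_Suc\<close> this says that \<open>x\<close> minus the
  derivative raises the index by one.\<close>

lemma has_derivative_hermite:
  "(hermite n has_real_derivative real n * hermite (n - 1) x) (at x)"
proof (induction n arbitrary: x rule: less_induct)
  case (less n)
  consider "n = 0" | "n = 1" | m where "n = Suc (Suc m)"
    by (metis One_nat_def not0_implies_Suc)
  then show ?case
  proof cases
    case 1
    have "hermite 0 = (\<lambda>_. 1)" by (rule ext) simp
    then show ?thesis using 1 by simp
  next
    case 2
    have "hermite (Suc 0) = (\<lambda>x. x)" by (rule ext) simp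
    then show ?thesis using 2 by simp
  next
    case 3
    have "hermite n = (\<lambda>x. x * hermite (Suc m) x - real (Suc m) * hermite m x)"
      by (rule ext) (simp add: 3)
    moreover have "((\<lambda>x. x * hermite (Suc m) x - real (Suc m) * hermite m x) has_real_derivative
        hermite (Suc m) x + x * (real (Suc m) * hermite m x)
          - real (Suc m) * (real m * hermite (m - 1) x)) (at x)"
      using 3 by (auto intro!: derivative_eq_intros less.IH[of "Suc m", simplified] less.IH[of m])
    moreover have "hermite (Suc m) x + x * (real (Suc m) * hermite m x)
          - real (Suc m) * (real m * hermite (m - 1) x) = real n * hermite (n - 1) x"
    proof -
      have "hermite (Suc m) x + x * (real (Suc m) * hermite m x)
            - real (Suc m) * (real m * hermite (m - 1) x)
          = hermite (Suc m) x + real (Suc m) * (x * hermite m x - real m * hermite (m - 1) x)"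
        by (simp add: algebra_simps)
      also have "\<dots> = real n * hermite (n - 1) x"
        by (simp only: hermite_Suc[of m x, symmetric]) (simp add: 3 ring_distribs del: hermite.simps)
      finally show ?thesis .
    qed
    ultimately show ?thesis by simp
  qed
qed

text \<open>The formal series \<open>H\<close> stands for the exponential of
  \<open>x * t - t\<^sup>2 / 2\<close> in the variable \<open>t\<close>. Its differential equation
  is the Hermite recursion for the coefficients, and its infinite radius of convergence allows
  evaluation at \<open>c\<close>. The factor \<open>B\<close> is the series of the exponential of
  \<open>- t\<^sup>2 / 2\<close>.\<close>

lemma hermite_generating_function:
  "(\<lambda>n. c ^ n * hermite n x / fact n) sums exp (c * x - c\<^sup>2 / 2)"
proof -
  define B :: "real fps" where
    "B = Abs_fps (\<lambda>n. if even n then (- 1 / 2) ^ (n div 2) / fact (n div 2) else 0)"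
  define H where "H = fps_exp x * B"
  have B_sums: "(\<lambda>n. fps_nth B n * r ^ n) sums exp (- r\<^sup>2 / 2)" for r
  proof -
    have "(\<lambda>n. (- r\<^sup>2 / 2) ^ n /\<^sub>R fact n) sums exp (- r\<^sup>2 / 2)"
      by (rule exp_converges)
    moreover have "(- r\<^sup>2 / 2) ^ n /\<^sub>R fact n = fps_nth B (2 * n) * r ^ (2 * n)" for n
    proof -
      have "(- r\<^sup>2 / 2) ^ n = ((- 1 / 2) * r\<^sup>2) ^ n" by simp
      also have "\<dots> = (- 1 / 2) ^ n * r ^ (2 * n)"
        by (simp only: power_mult_distrib power_mult)
      also have "(- 1 / 2) ^ n * r ^ (2 * n) = fps_nth B (2 * n) * r ^ (2 * n) * fact n"
        by (simp add: B_def)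
      finally show ?thesis by simp
    qed
    ultimately have "(\<lambda>n. fps_nth B (2 * n) * r ^ (2 * n)) sums exp (- r\<^sup>2 / 2)"
      by simp
    \<comment> \<open>The odd coefficients of \<open>B\<close> vanish, so the series over even
      indices is the whole series.\<close>
    then show ?thesis
      by (subst (asm) sums_mono_reindex[of "(*) 2" "\<lambda>n. fps_nth B n * r ^ n"])
         (auto simp: strict_mono_def B_def image_iff elim!: evenE)
  qed
  \<comment> \<open>The differential equation of the Gaussian, checked on coefficients. Only odd
    \<open>n\<close> is nontrivial: there the factor \<open>n + 1\<close> from the derivative
    cancels against the factorial.\<close>
  have B_deriv: "fps_deriv B = - fps_X * B"
  proof (rule fps_ext)
    fix n show "fps_nth (fps_deriv B) n = fps_nth (- fps_X * B) n"
    proof (cases n)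
      case (Suc m)
      show ?thesis
      proof (cases "even m")
        case True
        then obtain j where j: "m = 2 * j" by (elim evenE)
        have cancel: "2 * q * ((- 1 / 2) ^ Suc j / (q * fact j)) = - ((- 1 / 2) ^ j / fact j)"
          if "q \<noteq> 0" for q :: real
          using that by simp
        have "fps_nth (fps_deriv B) n =
            2 * real (Suc j) * ((- 1 / 2) ^ Suc j / (real (Suc j) * fact j))"
          by (simp add: Suc j B_def)
        then show ?thesis
          by (subst (asm) cancel) (simp_all add: Suc j B_def)
      qed (simp add: Suc B_def)
    qed (simp add: B_def)
  qed
  have H_deriv: "fps_deriv H = (fps_const x - fps_X) * H"
    by (simp add: H_def B_deriv algebra_simps)
  have rec: "real (Suc n) * fps_nth H (Suc n) =
      x * fps_nth H n - (if n = 0 then 0 else fps_nth H (n - 1))" for n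
    using arg_cong[OF H_deriv, of "\<lambda>f. fps_nth f n"] by (simp add: left_diff_distrib)
  have H: "fps_nth H n = hermite n x / fact n" for n
  proof (induction n rule: less_induct)
    case (less n)
    show ?case
    proof (cases n)
      case 0
      then show ?thesis by (simp add: H_def B_def)
    next
      case (Suc m)
      have frac: "real (Suc k) * y / fact (Suc k) = y / fact k" for k y
        unfolding fact_Suc by (rule mult_divide_mult_cancel_left) simp
      have "(if m = 0 then 0 else fps_nth H (m - 1)) = real m * hermite (m - 1) x / fact m"
      proof (cases m)
        case (Suc j)
        then show ?thesis
          using less[of j] \<open>n = Suc m\<close> frac[of j "hermite j x"] by simp
      qed simp
      then have "real n * fps_nth H n = hermite n x / fact m"
        using rec[of m] less[of m] Suc
        by (simp add: hermite_Suc[of m] diff_divide_distrib del: hermite.simps)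
      also have "\<dots> = real n * (hermite n x / fact n)"
        using frac[of m "hermite n x"] Suc by simp
      finally show ?thesis
        unfolding Suc mult_cancel_left by simp
    qed
  qed
  \<comment> \<open>\<open>B_sums\<close> gives convergence at every real \<open>r\<close>, so no
    finite radius is possible.\<close>
  have "fps_conv_radius B = \<infinity>"
  proof (rule ccontr)
    assume "fps_conv_radius B \<noteq> \<infinity>"
    moreover have "fps_conv_radius B \<ge> ereal r" if "r > 0" for r
      using B_sums[of r] conv_radius_geI[of "fps_nth B" r] that
      by (auto simp: fps_conv_radius_def sums_iff)
    ultimately show False
      by (metis ereal_less_eq(3) ereal_top gt_ex less_le_trans linorder_not_le nle_le)
  qed
  moreover have "fps_conv_radius (fps_exp x :: real fps) = \<infinity>" by simp
  ultimately have "eval_fps H c = exp (x * c) * exp (- c\<^sup>2 / 2)"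
      and "fps_conv_radius H = \<infinity>"
    using B_sums[of c] fps_conv_radius_mult[of "fps_exp x" B] unfolding H_def
    by (simp_all add: eval_fps_mult eval_fps_def[of B] sums_iff)
  then have "(\<lambda>n. fps_nth H n * c ^ n) sums exp (c * x - c\<^sup>2 / 2)"
    using sums_eval_fps[of c H] by (simp add: exp_add[symmetric] mult.commute)
  then show ?thesis by (simp add: H mult.commute)
qed

text \<open>On the line \<open>A\<close> is \<open>c\<close> times the raising operator
  (multiplication by the variable minus differentiation) in the variable
  \<open>x + \<epsilon>\<close>, so its iterates on the constant \<open>g\<close> are Hermite
  polynomials and the exponential series is their generating function.\<close>

lemma exp_adjoint_on_line:
  assumes A: "\<And>F u. A F u = \<zeta> u * (- D \<theta> F u + X u * F u)"
    and \<zeta>: "\<And>\<epsilon>. \<zeta> (w + \<epsilon> *\<^sub>R \<theta>) = c"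
    and X: "\<And>\<epsilon>. X (w + \<epsilon> *\<^sub>R \<theta>) = x + \<epsilon>"
    and F: "\<And>\<epsilon>. F (w + \<epsilon> *\<^sub>R \<theta>) = g"
  shows "exp_defined \<theta> A F w" and "exp_op A F w = g * exp (c * x - c\<^sup>2 / 2)"
proof -
  have deriv: "((\<lambda>\<epsilon>. g * c ^ n * hermite n (x + \<epsilon>)) has_real_derivative
      g * c ^ n * (real n * hermite (n - 1) (x + \<epsilon>))) (at \<epsilon>)" for n \<epsilon>
  proof (rule DERIV_cmult)
    have "((\<lambda>\<epsilon>. x + \<epsilon>) has_real_derivative 1) (at \<epsilon>)"
      by (auto intro!: derivative_eq_intros)
    from DERIV_chain'[OF this has_derivative_hermite]
    show "((\<lambda>\<epsilon>. hermite n (x + \<epsilon>)) has_real_derivative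
        real n * hermite (n - 1) (x + \<epsilon>)) (at \<epsilon>)"
      by simp
  qed
  have iter: "(A ^^ n) F (w + \<epsilon> *\<^sub>R \<theta>) = g * c ^ n * hermite n (x + \<epsilon>)" for n \<epsilon>
  proof (induction n arbitrary: \<epsilon>)
    case (Suc n)
    show ?case
      using D_eq[OF has_D_line[OF Suc deriv]] Suc[of \<epsilon>]
      by (simp add: A \<zeta> X hermite_Suc algebra_simps)
  qed (simp add: F)
  have "(A ^^ n) F w / fact n = g * (c ^ n * hermite n x / fact n)" for n
    using iter[of n 0] by simp
  then have sums: "(\<lambda>n. (A ^^ n) F w / fact n) sums (g * exp (c * x - c\<^sup>2 / 2))"
    using sums_mult[OF hermite_generating_function[of c x], of g] by simp
  then show "exp_op A F w = g * exp (c * x - c\<^sup>2 / 2)"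
    by (simp add: exp_op_def sums_iff)
  show "exp_defined \<theta> A F w"
    using has_D_line[OF iter deriv] sums by (auto simp: exp_defined_def sums_iff)
qed

lemma poly_functional_on_line:
  assumes F: "\<And>\<epsilon>. F (w + \<epsilon> *\<^sub>R \<theta>) =
      (\<Sum>\<alpha>\<in>A. c \<alpha> * (\<Prod>i<n. J i (w + \<epsilon> *\<^sub>R \<theta>) ^ \<alpha> i))"
    and J: "\<And>i \<epsilon>. i < n \<Longrightarrow> J i (w + \<epsilon> *\<^sub>R \<theta>) = b i + \<epsilon> * a i"
  shows "F (w + \<epsilon> *\<^sub>R \<theta>) = poly (\<Sum>\<alpha>\<in>A. smult (c \<alpha>) (\<Prod>i<n. [:b i, a i:] ^ \<alpha> i)) \<epsilon>"
  by (simp add: F poly_sum poly_prod J)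

section \<open>Paths, filtration and ramps\<close>

lemma apply_add: "apply_bcontfun (w + v) t = apply_bcontfun w t + apply_bcontfun v t"
  by (simp add: plus_bcontfun.rep_eq)

lemma apply_scaleR: "apply_bcontfun (c *\<^sub>R w) t = c * apply_bcontfun w t"
  by (simp add: scaleR_bcontfun.rep_eq)

lemma zero_in_paths: "0 \<in> paths"
  by (simp add: paths_def)

lemma paths_add:
  assumes "w \<in> paths" "v \<in> paths"
  shows "w + v \<in> paths"
  using assms unfolding paths_def mem_Collect_eq apply_add by (metis add_0)

lemma paths_scaleR:
  assumes "w \<in> paths"
  shows "c *\<^sub>R w \<in> paths"
  using assms unfolding paths_def mem_Collect_eq apply_scaleR by (metis mult_zero_right)

lemma paths_sum: "(\<And>i. i \<in> A \<Longrightarrow> f i \<in> paths) \<Longrightarrow> (\<Sum>i\<in>A. f i) \<in> paths"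
  by (induction A rule: infinite_finite_induct) (simp_all add: paths_add zero_in_paths)

lemma path_at_0: "w \<in> paths \<Longrightarrow> apply_bcontfun w 0 = 0"
  unfolding paths_def by blast

lemma apply_sum: "apply_bcontfun (\<Sum>i\<in>A. f i) t = (\<Sum>i\<in>A. apply_bcontfun (f i) t)"
  by (induction A rule: infinite_finite_induct) (simp_all add: apply_add)

lemma space_nat_filtration [simp]: "space (nat_filtration t) = paths"
  unfolding nat_filtration_def by (rule space_measure_of) auto

lemma sets_nat_filtration: "sets (nat_filtration t) = sigma_sets paths
     {(\<lambda>w. apply_bcontfun w u) -` B \<inter> paths | u B. 0 \<le> u \<and> u \<le> t \<and> u \<le> 1 \<and> B \<in> sets borel}"
  unfolding nat_filtration_def by (rule sets_measure_of) auto

lemma measurable_eval_nat_filtration: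
  assumes "0 \<le> u" "u \<le> t" "u \<le> 1"
  shows "(\<lambda>w. apply_bcontfun w u) \<in> borel_measurable (nat_filtration t)"
proof (rule measurableI)
  fix B :: "real set" assume "B \<in> sets borel"
  then show "(\<lambda>w. apply_bcontfun w u) -` B \<inter> space (nat_filtration t) \<in> sets (nat_filtration t)"
    using assms unfolding sets_nat_filtration by (auto intro!: sigma_sets.Basic)
qed simp

lemma measurable_into_nat_filtration:
  assumes "\<And>w. w \<in> space M \<Longrightarrow> f w \<in> paths"
    and "\<And>u. 0 \<le> u \<Longrightarrow> u \<le> t \<Longrightarrow> u \<le> 1 \<Longrightarrow> (\<lambda>w. apply_bcontfun (f w) u) \<in> borel_measurable M"
  shows "f \<in> measurable M (nat_filtration t)"
  unfolding nat_filtration_def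
proof (rule measurable_measure_of)
  show "f \<in> space M \<rightarrow> paths" using assms(1) by auto
  fix A assume "A \<in> {(\<lambda>w. apply_bcontfun w u) -` B \<inter> paths | u B.
      0 \<le> u \<and> u \<le> t \<and> u \<le> 1 \<and> B \<in> sets borel}"
  then obtain u B where A: "A = (\<lambda>w. apply_bcontfun w u) -` B \<inter> paths"
    and "0 \<le> u" "u \<le> t" "u \<le> 1" "B \<in> sets borel" by auto
  then have "(\<lambda>w. apply_bcontfun (f w) u) -` B \<inter> space M \<in> sets M"
    using assms(2) measurable_sets by blast
  moreover have "f -` A \<inter> space M = (\<lambda>w. apply_bcontfun (f w) u) -` B \<inter> space M"
    using assms(1) by (auto simp: A)
  ultimately show "f -` A \<inter> space M \<in> sets M" by simp
qed auto

lemma measurable_nat_filtration_mono: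
  assumes "t \<le> t'" "f \<in> borel_measurable (nat_filtration t)"
  shows "f \<in> borel_measurable (nat_filtration t')"
proof -
  have "(\<lambda>w. w) \<in> measurable (nat_filtration t') (nat_filtration t)"
    using assms(1) by (auto intro!: measurable_into_nat_filtration measurable_eval_nat_filtration)
  from measurable_compose[OF this assms(2)] show ?thesis .
qed

text \<open>The sets that do not separate \<open>w\<close> from \<open>v\<close> are closed under
  complements and countable unions and contain the generators. No null sets are added to the
  filtration, so the conclusion holds for every single pair of paths.\<close>

lemma nat_filtration_determined:
  fixes f :: "path \<Rightarrow> real"
  assumes f: "f \<in> borel_measurable (nat_filtration t)"
    and "w \<in> paths" "v \<in> paths"
    and agree: "\<And>u. 0 \<le> u \<Longrightarrow> u \<le> t \<Longrightarrow> u \<le> 1 \<Longrightarrow> apply_bcontfun w u = apply_bcontfun v u"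
  shows "f w = f v"
proof -
  have "w \<in> A \<longleftrightarrow> v \<in> A" if "A \<in> sets (nat_filtration t)" for A
    using that unfolding sets_nat_filtration
  proof (induction rule: sigma_sets.induct)
    case (Basic A)
    then show ?case using assms by auto
  qed (use assms in auto)
  from this[OF measurable_sets[OF f, of "{f v}"]] show ?thesis
    using assms by auto
qed

text \<open>For \<open>0 \<le> a \<le> b \<le> 1\<close> this path has slope \<open>\<kappa>\<close>
  on the interval and is constant outside it. The slope is left free so that multiples of Haar
  directions are again ramps.\<close>

definition ramp :: "real \<Rightarrow> real \<Rightarrow> real \<Rightarrow> path" where
  "ramp \<kappa> a b = primitive (\<lambda>u. \<kappa> * indicator {a<..b} u)"

lemma sigma_path_eq_ramp:
  "sigma_path s k = ramp (2 powr (real s / 2)) ((real k - 1) / 2^s) (real k / 2^s)"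
  by (simp add: sigma_path_def ramp_def)

lemma set_integrable_scaled_interval:
  "set_integrable lborel {0..1} (\<lambda>u::real. \<kappa> * indicator {a<..b} u :: real)"
proof -
  have "emeasure lborel ({0..1} \<inter> {a<..b}) \<le> emeasure lborel {0..1::real}"
    by (rule emeasure_mono) auto
  then have "emeasure lborel ({0..1} \<inter> {a<..b}) < \<infinity>"
    by (rule order.strict_trans1) simp
  then have "integrable lborel (indicator ({0..1} \<inter> {a<..b}) :: real \<Rightarrow> real)"
    by (intro integrable_real_indicator) auto
  then have "set_integrable lborel {0..1} (indicator {a<..b} :: real \<Rightarrow> real)"
    by (simp only: set_integrable_def indicator_inter_arith[abs_def] real_scaleR_def)
  then show ?thesis by (rule set_integrable_mult_right)
qed

lemma LBINT_scaled_interval: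
  fixes a b c d :: real
  shows "(LBINT u:{c..d}. \<kappa> * indicator {a<..b} u) = \<kappa> * measure lborel ({c..d} \<inter> {a<..b})"
proof -
  have "(LBINT u:{c..d}. \<kappa> * indicator {a<..b} u) = (\<integral>u. \<kappa> * indicator ({c..d} \<inter> {a<..b}) u \<partial>lborel)"
    unfolding set_lebesgue_integral_def
    by (rule Bochner_Integration.integral_cong) (auto simp: indicator_def)
  then show ?thesis by simp
qed

lemma ramp_in_paths: "ramp \<kappa> a b \<in> paths"
  unfolding ramp_def by (intro primitive_in_paths set_integrable_scaled_interval)

lemma apply_ramp:
  assumes "0 \<le> a" "a \<le> b" "b \<le> 1"
  shows "apply_bcontfun (ramp \<kappa> a b) t = \<kappa> * (max a (min t b) - a)"
proof -
  have "{0..min 1 t} \<inter> {a<..b} = (if t < a then {} else {a<..min t b})"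
    using assms by auto
  then have "measure lborel ({0..min 1 t} \<inter> {a<..b}) = max a (min t b) - a"
    using assms by auto
  then show ?thesis
    by (simp only: ramp_def apply_primitive[OF set_integrable_scaled_interval] LBINT_scaled_interval)
qed

lemma apply_add_ramp:
  assumes "0 \<le> a" "a \<le> b" "b \<le> 1" "u \<le> a"
  shows "apply_bcontfun (w + c *\<^sub>R ramp \<kappa> a b) u = apply_bcontfun w u"
  using assms by (simp add: apply_add apply_scaleR apply_ramp)

lemma scaleR_ramp:
  assumes "0 \<le> a" "a \<le> b" "b \<le> 1"
  shows "c *\<^sub>R ramp \<kappa> a b = ramp (c * \<kappa>) a b"
  by (rule bcontfun_eqI) (simp add: apply_scaleR apply_ramp[OF assms])

text \<open>The kinks are excluded. Being only two points, they disappear from measurability and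
  integrals below through the discrete-difference rules.\<close>

lemma has_derivative_ramp:
  assumes ab: "0 \<le> a" "a \<le> b" "b \<le> 1" and u: "u \<notin> {a, b}"
  shows "(apply_bcontfun (ramp \<kappa> a b) has_real_derivative \<kappa> * indicator {a<..b} u) (at u)"
proof -
  consider "u < a" | "a < u" "u < b" | "b < u" using u by fastforce
  then show ?thesis
  proof cases
    case 1
    show ?thesis
      by (rule has_field_derivative_transform_within_open[of "\<lambda>_. 0" _ _ "{..<a}"])
         (use 1 ab in \<open>auto simp: apply_ramp\<close>)
  next
    case 2
    show ?thesis
      by (rule has_field_derivative_transform_within_open[of "\<lambda>u. \<kappa> * (u - a)" _ _ "{a<..<b}"])
         (use 2 ab in \<open>auto simp: apply_ramp intro!: derivative_eq_intros\<close>)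
  next
    case 3
    show ?thesis
      by (rule has_field_derivative_transform_within_open[of "\<lambda>_. \<kappa> * (b - a)" _ _ "{b<..}"])
         (use 3 ab in \<open>auto simp: apply_ramp\<close>)
  qed
qed

lemma abs_cont01_lipschitz:
  assumes "\<And>x y. \<bar>f y - f x\<bar> \<le> C * \<bar>y - x\<bar>"
  shows "abs_cont01 f"
  unfolding abs_cont01_def
proof (intro allI impI)
  fix \<epsilon> :: real assume "\<epsilon> > 0"
  have C: "0 \<le> C" using assms[of 1 0] by simp
  show "\<exists>\<delta>>0. \<forall>(n::nat) a b. (\<forall>i<n. 0 \<le> a i \<and> a i \<le> b i \<and> b i \<le> 1) \<longrightarrow>
        (\<forall>i<n. \<forall>j<n. i \<noteq> j \<longrightarrow> {a i<..<b i} \<inter> {a j<..<b j} = {}) \<longrightarrow>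
        (\<Sum>i<n. b i - a i) < \<delta> \<longrightarrow> (\<Sum>i<n. \<bar>f (b i) - f (a i)\<bar>) < \<epsilon>"
  \<comment> \<open>The summand 1 keeps the denominator positive when \<open>C = 0\<close>.\<close>
  proof (intro exI[of _ "\<epsilon> / (C + 1)"] conjI allI impI)
    show "0 < \<epsilon> / (C + 1)" using \<open>\<epsilon> > 0\<close> C by simp
    fix n :: nat and a b :: "nat \<Rightarrow> real"
    assume ab: "\<forall>i<n. 0 \<le> a i \<and> a i \<le> b i \<and> b i \<le> 1"
      and small: "(\<Sum>i<n. b i - a i) < \<epsilon> / (C + 1)"
    have "(\<Sum>i<n. \<bar>f (b i) - f (a i)\<bar>) \<le> (\<Sum>i<n. C * (b i - a i))"
    proof (rule sum_mono)
      fix i assume "i \<in> {..<n}"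
      then show "\<bar>f (b i) - f (a i)\<bar> \<le> C * (b i - a i)"
        using assms[of "b i" "a i"] ab by auto
    qed
    also have "\<dots> \<le> (C + 1) * (\<Sum>i<n. b i - a i)"
      unfolding sum_distrib_left using ab C by (intro sum_mono mult_right_mono) auto
    also have "\<dots> < \<epsilon>"
      using small C by (simp add: field_simps)
    finally show "(\<Sum>i<n. \<bar>f (b i) - f (a i)\<bar>) < \<epsilon>" .
  qed
qed

lemma ramp_in_cameron_martin:
  assumes ab: "0 \<le> a" "a \<le> b" "b \<le> 1"
  shows "ramp \<kappa> a b \<in> cameron_martin"
proof -
  let ?r = "apply_bcontfun (ramp \<kappa> a b)"
  have deriv: "deriv ?r u = \<kappa> * indicator {a<..b} u" if "u \<notin> {a, b}" for u
    using DERIV_imp_deriv[OF has_derivative_ramp[OF ab that]] .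
  have "abs_cont01 ?r"
  proof (rule abs_cont01_lipschitz)
    fix x y :: real
    have "\<bar>max a (min y b) - max a (min x b)\<bar> \<le> \<bar>y - x\<bar>"
      by (auto simp: max_def min_def)
    then show "\<bar>?r y - ?r x\<bar> \<le> \<bar>\<kappa>\<bar> * \<bar>y - x\<bar>"
      by (simp add: apply_ramp[OF ab] right_diff_distrib[symmetric] abs_mult mult_left_mono)
  qed
  moreover have "AE t in lborel. t \<in> {0<..<1} \<longrightarrow> ?r field_differentiable (at t)"
    using AE_lborel_singleton[of a] AE_lborel_singleton[of b]
  proof eventually_elim
    case (elim u)
    then show ?case
      using has_derivative_ramp[OF ab, of u] unfolding field_differentiable_def by blast
  qed
  moreover have "set_borel_measurable lborel {0..1} (deriv ?r)"
    unfolding set_borel_measurable_def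
    by (rule measurable_discrete_difference[where X = "{a, b}"
          and f = "\<lambda>u. indicator {0..1} u *\<^sub>R (\<kappa> * indicator {a<..b} u)"])
       (auto simp: deriv)
  moreover have "set_integrable lborel {0..1} (\<lambda>t. (deriv ?r t)\<^sup>2)"
  proof -
    have "set_integrable lborel {0..1} (\<lambda>t. \<kappa>\<^sup>2 * indicator {a<..b} t :: real)"
      by (rule set_integrable_scaled_interval)
    then show ?thesis
      unfolding set_integrable_def
    proof (subst (asm) integrable_discrete_difference[where X = "{a, b}"
          and g = "\<lambda>t. indicator {0..1} t *\<^sub>R (deriv ?r t)\<^sup>2"])
      show "indicator {0..1} t *\<^sub>R (\<kappa>\<^sup>2 * indicator {a<..b} t) =
          indicator {0..1} t *\<^sub>R (deriv ?r t)\<^sup>2" if "t \<notin> {a, b}" for t :: real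
        unfolding deriv[OF that] by (simp add: indicator_def)
    qed auto
  qed
  ultimately show ?thesis
    by (simp add: cameron_martin_def ramp_in_paths)
qed

lemma cm_inner_ramp:
  assumes ab: "0 \<le> a" "a \<le> b" "b \<le> 1"
  shows "cm_inner h (ramp \<kappa> a b) =
    \<kappa> * (LBINT t:{0..1}. deriv (apply_bcontfun h) t * indicator {a<..b} t)"
proof -
  have "cm_inner h (ramp \<kappa> a b) =
      (LBINT t:{0..1}. \<kappa> * (deriv (apply_bcontfun h) t * indicator {a<..b} t))"
    unfolding cm_inner_def set_lebesgue_integral_def
    by (rule integral_discrete_difference[where X = "{a, b}"])
       (use DERIV_imp_deriv[OF has_derivative_ramp[OF ab]] in \<open>auto simp: mult_ac\<close>)
  then show ?thesis by simp
qed

text \<open>A ramp is the primitive of a step function with one step, so the convention on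
  elementary integrals fixes its Wiener integral at every path. This is the source of all statements
  without an exceptional set.\<close>

lemma wiener_integral_ramp:
  assumes I: "wiener_integrals \<gamma> I" and ab: "0 \<le> a" "a \<le> b" "b \<le> 1" and "w \<in> paths"
  shows "I (ramp \<kappa> a b) w = \<kappa> * (apply_bcontfun w b - apply_bcontfun w a)"
proof -
  let ?t = "\<lambda>i::nat. if i = 0 then a else b"
  have "partition 1 ?t"
    using ab by (simp add: partition_def)
  moreover have "step_fun 1 (\<lambda>_. \<kappa>) ?t = (\<lambda>u. \<kappa> * indicator {a<..b} u)"
    by (rule ext) (simp add: step_fun_def)
  moreover have "I (primitive (step_fun 1 (\<lambda>_. \<kappa>) ?t)) w = step_integral 1 (\<lambda>_. \<kappa>) ?t w"
    if "partition 1 ?t"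
    using I \<open>w \<in> paths\<close> that unfolding wiener_integrals_def by blast
  ultimately show ?thesis
    by (simp add: ramp_def step_integral_def)
qed

section \<open>Haar directions and the exponential chains\<close>

lemma dyadic_bounds:
  assumes "k \<in> {1..2^s}"
  shows "0 \<le> (real k - 1) / 2^s" "(real k - 1) / 2^s \<le> real k / 2^s" "real k / 2^s \<le> 1"
proof -
  show "0 \<le> (real k - 1) / 2^s" using assms by simp
  show "(real k - 1) / 2^s \<le> real k / 2^s" by (simp add: divide_right_mono)
  have "real k \<le> real (2 ^ s)" using assms by (simp only: of_nat_le_iff atLeastAtMost_iff)
  then show "real k / 2^s \<le> 1" by simp
qed

lemma sigma_path_in_paths: "sigma_path s k \<in> paths"
  by (simp add: sigma_path_eq_ramp ramp_in_paths)

lemma paths_line: "w \<in> paths \<Longrightarrow> w + \<epsilon> *\<^sub>R sigma_path s k \<in> paths"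
  by (intro paths_add paths_scaleR sigma_path_in_paths)

text \<open>The unit Cameron-Martin norm of \<open>sigma_path s k\<close>: slope squared times the
  length of the dyadic interval.\<close>

lemma haar_scaling: "2 powr (real s / 2) * (2 powr (real s / 2) / 2 ^ s) = (1::real)"
  by (simp add: powr_add[symmetric] powr_realpow)

text \<open>Up to time \<open>(k - 1) / 2^s\<close> the direction vanishes, and for
  \<open>j \<le> k\<close> this covers all times on which \<open>f\<close> depends.\<close>

lemma nat_filtration_line:
  fixes f :: "path \<Rightarrow> real"
  assumes f: "f \<in> borel_measurable (nat_filtration ((real j - 1) / 2^s))"
    and "j \<le> k" "k \<in> {1..2^s}" "w \<in> paths"
  shows "f (w + \<epsilon> *\<^sub>R sigma_path s k) = f w"
proof (rule nat_filtration_determined[OF f paths_line])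
  fix u assume "u \<le> (real j - 1) / 2^s"
  also have "\<dots> \<le> (real k - 1) / 2^s"
    using assms(2) by (simp add: divide_right_mono)
  finally show "apply_bcontfun (w + \<epsilon> *\<^sub>R sigma_path s k) u = apply_bcontfun w u"
    unfolding sigma_path_eq_ramp by (rule apply_add_ramp[OF dyadic_bounds[OF assms(3)]])
qed fact+

lemma wiener_integral_sigma_path:
  assumes "wiener_integrals \<gamma> I" "k \<in> {1..2^s}" "w \<in> paths"
  shows "I (sigma_path s k) w =
    2 powr (real s / 2) * (apply_bcontfun w (real k / 2^s) - apply_bcontfun w ((real k - 1) / 2^s))"
  unfolding sigma_path_eq_ramp
  by (rule wiener_integral_ramp[OF assms(1) dyadic_bounds[OF assms(2)] assms(3)])

lemma wiener_integral_sigma_path_affine: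
  assumes "wiener_integrals \<gamma> I" "k \<in> {1..2^s}" "w \<in> paths" "\<theta> \<in> paths"
  shows "I (sigma_path s k) (w + \<epsilon> *\<^sub>R \<theta>) =
    I (sigma_path s k) w + \<epsilon> * I (sigma_path s k) \<theta>"
  using assms
  by (simp add: wiener_integral_sigma_path paths_add paths_scaleR apply_add apply_scaleR algebra_simps)

text \<open>Orthonormality of the Haar directions at one level: for \<open>j < k\<close> the
  increment of \<open>sigma_path s k\<close> over the earlier interval is 0, and for
  \<open>j = k\<close> the normalization gives 1.\<close>

lemma wiener_integral_sigma_path_line:
  assumes I: "wiener_integrals \<gamma> I" and "1 \<le> j" "j \<le> k" "k \<in> {1..2^s}" "w \<in> paths"
  shows "I (sigma_path s j) (w + \<epsilon> *\<^sub>R sigma_path s k) =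
    I (sigma_path s j) w + (if j = k then \<epsilon> else 0)"
proof -
  have j: "j \<in> {1..2^s}" using assms by auto
  have "apply_bcontfun (sigma_path s k) (real j / 2^s)
      - apply_bcontfun (sigma_path s k) ((real j - 1) / 2^s)
    = (if j = k then 2 powr (real s / 2) / 2^s else 0)"
  proof (cases "j = k")
    case True
    then show ?thesis
      using dyadic_bounds[OF assms(4)]
      by (simp add: sigma_path_eq_ramp apply_ramp diff_divide_distrib right_diff_distrib)
  next
    case False
    then have "real j \<le> real k - 1" using \<open>j \<le> k\<close> by linarith
    then have "real j / 2^s \<le> (real k - 1) / 2^s" by (simp add: divide_right_mono)
    then show ?thesis
      using False dyadic_bounds[OF assms(4)] dyadic_bounds[OF j]
      by (simp add: sigma_path_eq_ramp apply_ramp)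
  qed
  then have "I (sigma_path s j) (sigma_path s k) = (if j = k then 1 else 0)"
    using haar_scaling[of s] by (simp add: wiener_integral_sigma_path[OF I j sigma_path_in_paths])
  then show ?thesis
    by (simp add: wiener_integral_sigma_path_affine[OF I j \<open>w \<in> paths\<close> sigma_path_in_paths])
qed

lemma set_integrable_simple_process: "set_integrable lborel {0..1} (simple_process s z w)"
  unfolding simple_process_def set_integrable_def scaleR_sum_right
  by (intro Bochner_Integration.integrable_sum set_integrable_scaled_interval[unfolded set_integrable_def])

text \<open>Splits the shift by the integrated process into shifts along single directions, one for
  each operator of the chain.\<close>

lemma primitive_simple_process:
  "primitive (simple_process s z w) = (\<Sum>k=1..2^s. z k w *\<^sub>R sigma_path s k)"
proof (rule bcontfun_eqI)
  fix t
  let ?f = "\<lambda>k u. 2 powr (real s / 2) * z k w * indicator {(real k - 1) / 2^s<..real k / 2^s} u"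
  have int: "set_integrable lborel {0..min 1 t} (?f k)" for k
    by (rule set_integrable_subset[OF set_integrable_scaled_interval]) auto
  have "apply_bcontfun (primitive (simple_process s z w)) t =
      (LBINT u:{0..min 1 t}. (\<Sum>k=1..2^s. ?f k u))"
    by (simp add: apply_primitive[OF set_integrable_simple_process])
       (simp add: simple_process_def)
  also have "\<dots> = (\<Sum>k=1..2^s. LBINT u:{0..min 1 t}. ?f k u)"
    using int unfolding set_lebesgue_integral_def set_integrable_def scaleR_sum_right
    by (rule Bochner_Integration.integral_sum)
  also have "\<dots> = (\<Sum>k=1..2^s. apply_bcontfun (z k w *\<^sub>R sigma_path s k) t)"
  proof (rule sum.cong[OF refl])
    fix k :: nat assume "k \<in> {1..2^s}"
    note d = dyadic_bounds[OF this]
    have "(LBINT u:{0..min 1 t}. ?f k u) =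
        apply_bcontfun (ramp (2 powr (real s / 2) * z k w) ((real k - 1) / 2^s) (real k / 2^s)) t"
      by (simp only: ramp_def apply_primitive[OF set_integrable_scaled_interval])
    also have "\<dots> = apply_bcontfun (z k w *\<^sub>R sigma_path s k) t"
      by (simp add: sigma_path_eq_ramp scaleR_ramp[OF d] mult.commute)
    finally show "(LBINT u:{0..min 1 t}. ?f k u) = apply_bcontfun (z k w *\<^sub>R sigma_path s k) t" .
  qed
  finally show "apply_bcontfun (primitive (simple_process s z w)) t =
      apply_bcontfun (\<Sum>k=1..2^s. z k w *\<^sub>R sigma_path s k) t"
    by (simp add: apply_sum)
qed

text \<open>The Wiener integrals entering \<open>F\<close> are elementary, hence affine on every
  line through every path.\<close>

lemma polyPH_on_line:
  assumes I: "wiener_integrals \<gamma> I" and F: "F \<in> polyPH I" and w: "w \<in> paths" and k: "k \<in> {1..2^s}"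
  obtains p where "\<And>\<epsilon>. F (w + \<epsilon> *\<^sub>R sigma_path s k) = poly p \<epsilon>"
proof -
  obtain n :: nat and h A c where h: "\<forall>i<n. h i \<in> {sigma_path s k | s k. k \<in> {1..2^s}}"
    and F: "\<forall>w\<in>paths. F w = (\<Sum>\<alpha>\<in>A. c \<alpha> * (\<Prod>i<n. I (h i) w ^ \<alpha> i))"
    using F unfolding poly_functionals_def by (elim CollectE exE conjE) (rule that; assumption)
  have aff: "I (h i) (w + \<epsilon> *\<^sub>R sigma_path s k) = I (h i) w + \<epsilon> * I (h i) (sigma_path s k)"
    if i: "i < n" for i \<epsilon>
  proof -
    obtain s' k' where "h i = sigma_path s' k'" "k' \<in> {1..2^s'}" using h i by blast
    then show ?thesis
      using wiener_integral_sigma_path_affine[OF I _ w sigma_path_in_paths] by metis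
  qed
  show ?thesis
    by (rule that, rule poly_functional_on_line[OF bspec[OF F paths_line[OF w]] aff])
qed

section \<open>The two exponential chains for an adapted family \<open>z\<close>\<close>

context
  fixes s :: nat and z :: "nat \<Rightarrow> path \<Rightarrow> real" and I :: "path \<Rightarrow> path \<Rightarrow> real" and \<gamma> :: "path measure"
  assumes I: "wiener_integrals \<gamma> I"
    and z: "\<forall>k\<in>{1..2^s}. z k \<in> borel_measurable (nat_filtration ((real k - 1) / 2^s))"
begin

lemma z_line:
  assumes "1 \<le> j" "j \<le> k" "k \<in> {1..2^s}" "w \<in> paths"
  shows "z j (w + \<epsilon> *\<^sub>R sigma_path s k) = z j w"
  using z assms by (intro nat_filtration_line[of "z j" j]) auto

text \<open>\<open>E\<close> need not be a polynomial functional, since the \<open>z j\<close> are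
  arbitrary adapted variables. But along \<open>sigma_path s (Suc k)\<close> the earlier
  \<open>z j\<close> do not change, so there \<open>E\<close> is \<open>F\<close> on the parallel
  line through the already shifted path, hence a polynomial in the parameter.\<close>

lemma exp_Dz_step:
  assumes F: "F \<in> polyPH I" and k: "Suc k \<in> {1..2^s}" and w: "w \<in> paths"
    and chain: "\<And>w. w \<in> paths \<Longrightarrow> E w = F (w + (\<Sum>j=1..k. z j w *\<^sub>R sigma_path s j))"
  shows "exp_defined (sigma_path s (Suc k)) (Dz s z (Suc k)) E w"
    and "exp_op (Dz s z (Suc k)) E w = F (w + (\<Sum>j=1..Suc k. z j w *\<^sub>R sigma_path s j))"
proof -
  let ?S = "\<Sum>j=1..k. z j w *\<^sub>R sigma_path s j"
  have S: "w + ?S \<in> paths"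
    by (intro paths_add w paths_sum paths_scaleR sigma_path_in_paths)
  obtain p where p: "\<And>\<epsilon>. F ((w + ?S) + \<epsilon> *\<^sub>R sigma_path s (Suc k)) = poly p \<epsilon>"
    using polyPH_on_line[OF I F S k] by blast
  have "(\<Sum>j=1..k. z j (w + \<epsilon> *\<^sub>R sigma_path s (Suc k)) *\<^sub>R sigma_path s j) = ?S" for \<epsilon>
    using k w by (intro sum.cong refl arg_cong2[where f = scaleR] z_line) auto
  then have E: "E (w + \<epsilon> *\<^sub>R sigma_path s (Suc k)) = poly p \<epsilon>" for \<epsilon>
    using chain[OF paths_line[OF w], of \<epsilon> s "Suc k"] p[of \<epsilon>] by (simp add: algebra_simps)
  note line = exp_derivation_on_line[where A = "Dz s z (Suc k)", OF Dz_def z_line[OF _ order.refl k w] E]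
  show "exp_defined (sigma_path s (Suc k)) (Dz s z (Suc k)) E w"
    by (rule line(1)) simp
  have "exp_op (Dz s z (Suc k)) E w = poly p (z (Suc k) w)"
    by (rule line(2)) simp
  then show "exp_op (Dz s z (Suc k)) E w = F (w + (\<Sum>j=1..Suc k. z j w *\<^sub>R sigma_path s j))"
    by (simp add: p[symmetric] add.assoc)
qed

lemma exp_chain_Dz:
  assumes F: "F \<in> polyPH I" and "k \<le> 2^s" and "w \<in> paths"
  shows "exp_chain (Dz s z) k F w = F (w + (\<Sum>j=1..k. z j w *\<^sub>R sigma_path s j))"
  using assms(2,3)
proof (induction k arbitrary: w)
  case (Suc k)
  then show ?case
    using exp_Dz_step(2)[OF F, of k w "exp_chain (Dz s z) k F"] by simp
qed simp

lemma exp_chain_Dz_defined: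
  assumes F: "F \<in> polyPH I" and k: "k \<in> {1..2^s}" and w: "w \<in> paths"
  shows "exp_defined (sigma_path s k) (Dz s z k) (exp_chain (Dz s z) (k - 1) F) w"
proof -
  obtain j where j: "k = Suc j" using k by (cases k) auto
  show ?thesis
    using exp_Dz_step(1)[OF F, of j w "exp_chain (Dz s z) j F"] exp_chain_Dz[OF F, of j] k w
    by (simp add: j)
qed

text \<open>Invariance of \<open>F\<close> is asked for only on the line through \<open>w\<close>.
  In this form the lemma applies both to adapted variables and to the partial products in the
  chain.\<close>

lemma exp_Dz_star:
  assumes k: "k \<in> {1..2^s}" and w: "w \<in> paths"
    and F: "\<And>\<epsilon>. F (w + \<epsilon> *\<^sub>R sigma_path s k) = F w"
  shows "exp_defined (sigma_path s k) (Dz_star I s z k) F w"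
    and "exp_op (Dz_star I s z k) F w = F w * exp (z k w * I (sigma_path s k) w - (z k w)\<^sup>2 / 2)"
proof -
  have A: "Dz_star I s z k F u = z k u * (- D (sigma_path s k) F u + I (sigma_path s k) u * F u)"
    for F u by (simp add: Dz_star_def D_star_def)
  have "1 \<le> k" using k by simp
  note line = exp_adjoint_on_line[where A = "Dz_star I s z k" and \<zeta> = "z k"
        and X = "I (sigma_path s k)" and \<theta> = "sigma_path s k" and F = F and w = w, OF A z_line[OF this order.refl k w]
      wiener_integral_sigma_path_line[OF I this order.refl k w, simplified] F]
  show "exp_defined (sigma_path s k) (Dz_star I s z k) F w"
    by (rule line(1))
  show "exp_op (Dz_star I s z k) F w = F w * exp (z k w * I (sigma_path s k) w - (z k w)\<^sup>2 / 2)"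
    by (rule line(2))
qed

abbreviation log_density :: "nat \<Rightarrow> path \<Rightarrow> real" where
  "log_density k w \<equiv> \<Sum>j=1..k. z j w * I (sigma_path s j) w - (z j w)\<^sup>2 / 2"

text \<open>The factors collected so far involve \<open>z j\<close> and the integral of
  \<open>sigma_path s j\<close> for \<open>j \<le> k\<close> only. None of these changes along the
  next direction, so the next operator multiplies by one more factor.\<close>

lemma exp_Dz_star_step:
  assumes k: "Suc k \<in> {1..2^s}" and w: "w \<in> paths"
    and chain: "\<And>w. w \<in> paths \<Longrightarrow> E w = exp (log_density k w)"
  shows "exp_defined (sigma_path s (Suc k)) (Dz_star I s z (Suc k)) E w"
    and "exp_op (Dz_star I s z (Suc k)) E w = exp (log_density (Suc k) w)"
proof -
  have "E (w + \<epsilon> *\<^sub>R sigma_path s (Suc k)) = E w" for \<epsilon>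
  proof -
    have "log_density k (w + \<epsilon> *\<^sub>R sigma_path s (Suc k)) = log_density k w"
      using k w
      by (intro sum.cong refl)
         (auto simp: z_line wiener_integral_sigma_path_line[OF I])
    then show ?thesis by (simp add: chain w paths_line)
  qed
  note step = exp_Dz_star[OF k w, of E, OF this]
  show "exp_defined (sigma_path s (Suc k)) (Dz_star I s z (Suc k)) E w"
    by (rule step(1))
  show "exp_op (Dz_star I s z (Suc k)) E w = exp (log_density (Suc k) w)"
    unfolding step(2) by (simp add: chain[OF w] exp_add)
qed

lemma exp_chain_Dz_star:
  assumes "k \<le> 2^s" and "w \<in> paths"
  shows "exp_chain (Dz_star I s z) k (\<lambda>_. 1) w = exp (log_density k w)"
  using assms
proof (induction k arbitrary: w)
  case (Suc k)
  then show ?case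
    using exp_Dz_star_step(2)[of k w "exp_chain (Dz_star I s z) k (\<lambda>_. 1)"] by simp
qed simp

lemma exp_chain_Dz_star_defined:
  assumes k: "k \<in> {1..2^s}" and w: "w \<in> paths"
  shows "exp_defined (sigma_path s k) (Dz_star I s z k) (exp_chain (Dz_star I s z) (k - 1) (\<lambda>_. 1)) w"
proof -
  obtain j where j: "k = Suc j" using k by (cases k) auto
  show ?thesis
    using exp_Dz_star_step(1)[of j w "exp_chain (Dz_star I s z) j (\<lambda>_. 1)"]
      exp_chain_Dz_star[of j] k w
    by (simp add: j)
qed

text \<open>Cross terms vanish because the dyadic intervals are disjoint, and the squared height
  times the length of each interval is 1.\<close>

lemma integral_simple_process_square:
  "(LBINT t:{0..1}. (simple_process s z w t)\<^sup>2) = (\<Sum>k=1..2^s. (z k w)\<^sup>2)"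
proof -
  let ?i = "\<lambda>k t. indicator {(real k - 1) / 2^s<..real k / 2^s} t :: real"
  let ?c = "\<lambda>k. 2 powr (real s / 2) * z k w"
  have disj: "?i j t * ?i k t = 0" if "j \<noteq> k" for j k :: nat and t :: real
  proof -
    have "real j \<le> real k - 1 \<or> real k \<le> real j - 1"
      using that by linarith
    then have "real j / 2^s \<le> (real k - 1) / 2^s \<or> real k / 2^s \<le> (real j - 1) / 2^s"
      by (auto intro!: divide_right_mono)
    then show ?thesis by (auto simp: indicator_def)
  qed
  have "(simple_process s z w t)\<^sup>2 = (\<Sum>k=1..2^s. (?c k)\<^sup>2 * ?i k t)" for t
  proof -
    have "(simple_process s z w t)\<^sup>2 = (\<Sum>j=1..2^s. \<Sum>k=1..2^s. (?c j * ?i j t) * (?c k * ?i k t))"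
      by (simp only: simple_process_def power2_eq_square sum_product)
    also have "\<dots> = (\<Sum>j=1..2^s. \<Sum>k=1..2^s. if k = j then (?c j)\<^sup>2 * ?i j t else 0)"
    proof (intro sum.cong refl)
      fix j k :: nat
      show "(?c j * ?i j t) * (?c k * ?i k t) = (if k = j then (?c j)\<^sup>2 * ?i j t else 0)"
        using disj[of j k t] by (auto simp: power2_eq_square indicator_def)
    qed
    finally show ?thesis by simp
  qed
  then have "(LBINT t:{0..1}. (simple_process s z w t)\<^sup>2) =
      (LBINT t:{0..1}. (\<Sum>k=1..2^s. (?c k)\<^sup>2 * ?i k t))"
    by simp
  also have "\<dots> = (\<Sum>k=1..2^s. LBINT t:{0..1}. (?c k)\<^sup>2 * ?i k t)"
    using set_integrable_scaled_interval
    unfolding set_lebesgue_integral_def set_integrable_def scaleR_sum_right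
    by (rule Bochner_Integration.integral_sum)
  also have "\<dots> = (\<Sum>k=1..2^s. (z k w)\<^sup>2)"
  proof (rule sum.cong[OF refl])
    fix k :: nat assume "k \<in> {1..2^s}"
    note d = dyadic_bounds[OF this]
    have "{0..1} \<inter> {(real k - 1) / 2^s<..real k / 2^s} = {(real k - 1) / 2^s<..real k / 2^s}"
    proof (rule Int_absorb1, rule subsetI)
      fix t assume "t \<in> {(real k - 1) / 2^s<..real k / 2^s}"
      then show "t \<in> {0..1}"
        using d unfolding greaterThanAtMost_iff atLeastAtMost_iff by linarith
    qed
    then have "(LBINT t:{0..1}. (?c k)\<^sup>2 * ?i k t) = (?c k)\<^sup>2 * (real k / 2^s - (real k - 1) / 2^s)"
      using d(2) by (simp only: LBINT_scaled_interval) simp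
    also have "\<dots> = (z k w)\<^sup>2 * (2 powr (real s / 2) * (2 powr (real s / 2) / 2 ^ s))"
      by (simp add: power2_eq_square diff_divide_distrib)
    finally show "(LBINT t:{0..1}. (?c k)\<^sup>2 * ?i k t) = (z k w)\<^sup>2"
      by (simp only: haar_scaling mult_1_right)
  qed
  finally show ?thesis .
qed

lemma log_density_eq:
  assumes "w \<in> paths"
  shows "log_density (2^s) w =
    simple_ito s z w - 1/2 * (LBINT t:{0..1}. (simple_process s z w t)\<^sup>2)"
  unfolding integral_simple_process_square simple_ito_def sum_distrib_left sum_subtractf
  using assms by (simp add: wiener_integral_sigma_path[OF I] mult_ac)

end

section \<open>The Cameron-Martin formula in a Haar direction\<close>

lemma normal_density_shift:
  assumes "0 < v"
  shows "normal_density 0 (sqrt v) (d * v + x) * exp (d * (d * v + x) - d\<^sup>2 * v / 2) =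
    normal_density 0 (sqrt v) x"
proof -
  have "- (d * v + x)\<^sup>2 / (2 * v) + (d * (d * v + x) - d\<^sup>2 * v / 2) = - x\<^sup>2 / (2 * v)"
    using assms by (simp add: divide_simps) (simp add: algebra_simps power2_eq_square)
  then have "exp (- (d * v + x)\<^sup>2 / (2 * v)) * exp (d * (d * v + x) - d\<^sup>2 * v / 2) =
      exp (- x\<^sup>2 / (2 * v))"
    by (simp only: exp_add[symmetric])
  then show ?thesis
    using assms by (simp add: normal_density_def mult.assoc)
qed

text \<open>Translate the Lebesgue integral by \<open>d * v\<close> and complete the square. The
  shift has this form because a path of slope \<open>d\<close> moves an increment over a time
  interval of length \<open>v\<close> by \<open>d * v\<close>.\<close>

lemma (in prob_space) normal_cameron_martin:
  assumes X: "distributed M lborel X (\<lambda>x. ennreal (normal_density 0 (sqrt v) x))" and "0 < v"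
    and [measurable]: "B \<in> sets borel"
  shows "(\<integral>\<^sup>+w. indicator B (X w + d * v) \<partial>M) =
    (\<integral>\<^sup>+w. indicator B (X w) * ennreal (exp (d * X w - d\<^sup>2 * v / 2)) \<partial>M)"
proof -
  let ?\<phi> = "\<lambda>x. ennreal (normal_density 0 (sqrt v) x)"
  have "(\<integral>\<^sup>+w. indicator B (X w) * ennreal (exp (d * X w - d\<^sup>2 * v / 2)) \<partial>M) =
      (\<integral>\<^sup>+x. ?\<phi> x * (indicator B x * ennreal (exp (d * x - d\<^sup>2 * v / 2))) \<partial>lborel)"
    by (rule distributed_nn_integral[OF X, symmetric]) simp
  also have "\<dots> = (\<integral>\<^sup>+x. ?\<phi> (d * v + x) * (indicator B (d * v + x) *
      ennreal (exp (d * (d * v + x) - d\<^sup>2 * v / 2))) \<partial>lborel)"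
    by (subst nn_integral_real_affine[where c = 1 and t = "d * v"]) simp_all
  also have "\<dots> = (\<integral>\<^sup>+x. ?\<phi> x * indicator B (x + d * v) \<partial>lborel)"
  proof (rule nn_integral_cong)
    fix x
    have "?\<phi> (d * v + x) * (indicator B (d * v + x) *
        ennreal (exp (d * (d * v + x) - d\<^sup>2 * v / 2))) =
      ?\<phi> (d * v + x) * ennreal (exp (d * (d * v + x) - d\<^sup>2 * v / 2)) * indicator B (d * v + x)"
      by (simp only: mult_ac)
    also have "?\<phi> (d * v + x) * ennreal (exp (d * (d * v + x) - d\<^sup>2 * v / 2)) = ?\<phi> x"
      by (subst ennreal_mult[symmetric]) (simp_all add: normal_density_shift[OF \<open>0 < v\<close>])
    finally show "?\<phi> (d * v + x) * (indicator B (d * v + x) *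
        ennreal (exp (d * (d * v + x) - d\<^sup>2 * v / 2))) = ?\<phi> x * indicator B (x + d * v)"
      by (simp only: add.commute)
  qed
  also have "\<dots> = (\<integral>\<^sup>+w. indicator B (X w + d * v) \<partial>M)"
    by (rule distributed_nn_integral[OF X]) simp
  finally show ?thesis ..
qed

lemma sorted_enumeration:
  fixes K :: "real set"
  assumes "finite K" "K \<noteq> {}"
  obtains m :: nat and t where "\<And>i. i < m \<Longrightarrow> t i < t (Suc i)" "K = t ` {..m}"
proof -
  define l where "l = sorted_list_of_set K"
  have l: "set l = K" "sorted_wrt (<) l" "length l \<noteq> 0"
    using assms by (auto simp: l_def sorted_list_of_set.strict_sorted_key_list_of_set)
  show ?thesis
  proof (rule that[of "length l - 1" "(!) l"])
    show "l ! i < l ! Suc i" if "i < length l - 1" for i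
      using sorted_wrt_nth_less[OF l(2), of i "Suc i"] that by simp
    have "{..length l - 1} = {..<length l}"
      using l(3) by (simp only: set_eq_iff atMost_iff lessThan_iff) linarith
    then show "K = (!) l ` {..length l - 1}"
      unfolding l(1)[symmetric] set_conv_nth by auto
  qed
qed

text \<open>Only one interval matters for the duality. The assumption \<open>normalized\<close>
  gives the ramp unit Cameron-Martin norm, equivalently the variable \<open>X\<close> variance
  1.\<close>

locale haar_direction =
  fixes \<gamma> :: "path measure" and a b \<kappa> :: real
  assumes wiener: "wiener_measure \<gamma>"
    and ab: "0 \<le> a" "a < b" "b \<le> 1"
    and normalized: "\<kappa>\<^sup>2 * (b - a) = 1"
begin

sublocale prob_space \<gamma>
  using wiener by (simp add: wiener_measure_def)

abbreviation "N \<equiv> nat_filtration 1"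
abbreviation "\<sigma> \<equiv> ramp \<kappa> a b"
definition X :: "path \<Rightarrow> real" where
  "X w = \<kappa> * (apply_bcontfun w b - apply_bcontfun w a)"
definition T :: "path \<Rightarrow> path" where
  "T w = w + (- X w) *\<^sub>R \<sigma>"

lemma space_\<gamma> [simp]: "space \<gamma> = paths"
proof -
  have "sets \<gamma> = sets (restrict_space borel paths)"
    using wiener by (simp add: wiener_measure_def)
  from sets_eq_imp_space_eq[OF this] show ?thesis
    by (simp add: space_restrict_space)
qed

lemma increment_distributed:
  assumes "0 \<le> u" "u < v" "v \<le> 1"
  shows "distributed \<gamma> lborel (\<lambda>w. apply_bcontfun w v - apply_bcontfun w u)
    (\<lambda>x. ennreal (normal_density 0 (sqrt (v - u)) x))"
  using wiener assms by (simp add: wiener_measure_def)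

lemma measurable_eval:
  assumes "0 \<le> u" "u \<le> 1"
  shows "(\<lambda>w. apply_bcontfun w u) \<in> borel_measurable \<gamma>"
proof (cases "u = 0")
  case True
  then show ?thesis
    by (subst measurable_cong[where g = "\<lambda>_. 0"]) (simp_all add: path_at_0)
next
  case False
  with assms have "(\<lambda>w. apply_bcontfun w u - apply_bcontfun w 0) \<in> measurable \<gamma> lborel"
    by (intro distributed_measurable[OF increment_distributed]) auto
  then show ?thesis
    by (subst measurable_cong[where g = "\<lambda>w. apply_bcontfun w u - apply_bcontfun w 0"])
       (simp_all add: path_at_0)
qed

lemma measurable_X [measurable]: "X \<in> borel_measurable \<gamma>"
  unfolding X_def using ab
  by (intro borel_measurable_times borel_measurable_diff measurable_eval) auto

lemma measurable_id [measurable]: "(\<lambda>w. w) \<in> measurable \<gamma> N"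
  by (rule measurable_into_nat_filtration) (auto intro: measurable_eval)

lemma X_N [measurable]: "X \<in> borel_measurable N"
  unfolding X_def using ab
  by (intro borel_measurable_times borel_measurable_diff measurable_eval_nat_filtration
      borel_measurable_const) auto

lemma T_in_paths: "w \<in> paths \<Longrightarrow> T w \<in> paths"
  unfolding T_def by (intro paths_add paths_scaleR ramp_in_paths)

lemma T_N [measurable]: "T \<in> measurable N N"
proof (rule measurable_into_nat_filtration)
  fix u :: real assume "0 \<le> u" "u \<le> 1"
  note [measurable] = measurable_eval_nat_filtration[OF this(1) this(2) this(2)]
  show "(\<lambda>w. apply_bcontfun (T w) u) \<in> borel_measurable N"
    unfolding T_def apply_add apply_scaleR by measurable
qed (simp add: T_in_paths)

lemma measurable_T [measurable]: "T \<in> measurable \<gamma> N"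
  using measurable_compose[OF measurable_id T_N] .

lemma measurable_shift: "(\<lambda>w. w + c *\<^sub>R \<sigma>) \<in> measurable \<gamma> N"
proof (rule measurable_into_nat_filtration)
  fix u :: real assume "0 \<le> u" "u \<le> 1"
  note [measurable] = measurable_eval[OF this]
  show "(\<lambda>w. apply_bcontfun (w + c *\<^sub>R \<sigma>) u) \<in> borel_measurable \<gamma>"
    unfolding apply_add apply_scaleR by measurable
qed (simp add: paths_add paths_scaleR ramp_in_paths)

text \<open>By \<open>normalized\<close>, \<open>X\<close> takes the value 1 at
  \<open>\<sigma>\<close>. It follows that \<open>T\<close>, which subtracts the
  \<open>\<sigma>\<close> component, is invariant under these shifts.\<close>

lemma X_shift: "X (w + c *\<^sub>R \<sigma>) = X w + c"
proof -
  have "X (w + c *\<^sub>R \<sigma>) = X w + c * (\<kappa>\<^sup>2 * (b - a))"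
    using ab by (simp add: X_def apply_add apply_scaleR apply_ramp algebra_simps power2_eq_square)
  then show ?thesis by (simp add: normalized)
qed

lemma T_shift: "T (w + c *\<^sub>R \<sigma>) = T w"
  by (simp add: T_def X_shift algebra_simps)

text \<open>With \<open>a\<close> and \<open>b\<close> among the partition points, each interval
  lies inside or outside the ramp and its increment is shifted by a constant. Independence then
  reduces both sides to products of one-dimensional Gaussian integrals.\<close>

lemma cameron_martin_rectangle:
  assumes t: "\<And>i. i < m \<Longrightarrow> t i < t (Suc i)" "0 \<le> t 0" "t m \<le> 1"
    and pq: "p \<le> q" "q \<le> m" "t p = a" "t q = b"
    and B: "\<And>i. i < m \<Longrightarrow> B i \<in> sets borel"
  defines "\<Delta> \<equiv> \<lambda>i w. apply_bcontfun w (t (Suc i)) - apply_bcontfun w (t i)"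
  shows "(\<integral>\<^sup>+w. (\<Prod>i<m. indicator (B i) (\<Delta> i (w + c *\<^sub>R \<sigma>))) \<partial>\<gamma>) =
    (\<integral>\<^sup>+w. (\<Prod>i<m. indicator (B i) (\<Delta> i w)) * ennreal (exp (c * X w - c\<^sup>2 / 2)) \<partial>\<gamma>)"
proof -
  \<comment> \<open>The slope of \<open>c *\<^sub>R \<sigma>\<close> on the interval with index
    \<open>i\<close>; below, \<open>v i\<close> is both its length and the variance of the
    increment.\<close>
  define d where "d i = (if p \<le> i \<and> i < q then c * \<kappa> else 0)" for i
  define v where "v i = t (Suc i) - t i" for i
  have mono: "t i \<le> t j" if "i \<le> j" "j \<le> m" for i j
    using that
  proof (induction j rule: dec_induct)
    case (step n)
    then show ?case using t(1)[of n] by auto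
  qed simp
  have range: "0 \<le> t i" "t i \<le> 1" if "i \<le> m" for i
    using mono[of 0 i] mono[of i m] t(2,3) that by auto
  have v: "0 < v i" if "i < m" for i using t(1)[OF that] by (simp add: v_def)
  have dist: "distributed \<gamma> lborel (\<Delta> i) (\<lambda>x. ennreal (normal_density 0 (sqrt (v i)) x))"
    if "i < m" for i
    unfolding \<Delta>_def v_def using that t(1)[OF that] range[of i] range[of "Suc i"]
    by (intro increment_distributed) auto
  have "partition m t"
    using t by (auto simp: partition_def less_imp_le)
  then have indep: "indep_vars (\<lambda>_. borel) \<Delta> {..<m}"
    using wiener unfolding wiener_measure_def \<Delta>_def by blast
  have \<Delta>_shift: "\<Delta> i (w + c *\<^sub>R \<sigma>) = \<Delta> i w + d i * v i" if "i < m" for i w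
  proof -
    consider "i < p" | "p \<le> i" "i < q" | "q \<le> i" by linarith
    then show ?thesis
    proof cases
      case 1
      then show ?thesis
        using mono[of "Suc i" p] t(1)[OF that] pq ab
        by (simp add: \<Delta>_def d_def apply_add apply_scaleR apply_ramp)
    next
      case 2
      then show ?thesis
        using mono[of p i] mono[of "Suc i" q] t(1)[OF that] pq ab
        by (simp add: \<Delta>_def d_def v_def apply_add apply_scaleR apply_ramp algebra_simps)
    next
      case 3
      then show ?thesis
        using mono[of q i] t(1)[OF that] that pq ab
        by (simp add: \<Delta>_def d_def apply_add apply_scaleR apply_ramp)
    qed
  qed
  have restrict: "(\<Sum>i<m. if p \<le> i \<and> i < q then f i else 0) = sum f {p..<q}" for f :: "nat \<Rightarrow> real"
    using pq by (subst sum.inter_filter[symmetric]) (auto intro!: sum.cong)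
  have "(\<Sum>i<m. d i * \<Delta> i w) = c * X w" for w
  proof -
    have "(\<Sum>i<m. d i * \<Delta> i w) = (\<Sum>i<m. if p \<le> i \<and> i < q then c * \<kappa> * \<Delta> i w else 0)"
      by (rule sum.cong) (auto simp: d_def)
    also have "\<dots> = c * \<kappa> * (\<Sum>i\<in>{p..<q}. \<Delta> i w)"
      unfolding restrict sum_distrib_left ..
    also have "\<dots> = c * X w"
      using sum_Suc_diff'[OF pq(1), of "\<lambda>i. apply_bcontfun w (t i)"] pq
      by (simp add: \<Delta>_def X_def)
    finally show ?thesis .
  qed
  moreover have "(\<Sum>i<m. (d i)\<^sup>2 * v i / 2) = c\<^sup>2 / 2"
  proof -
    have "(\<Sum>i<m. (d i)\<^sup>2 * v i / 2) = (\<Sum>i<m. if p \<le> i \<and> i < q then (c * \<kappa>)\<^sup>2 / 2 * v i else 0)"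
      by (rule sum.cong) (auto simp: d_def)
    also have "\<dots> = (c * \<kappa>)\<^sup>2 / 2 * (\<Sum>i\<in>{p..<q}. v i)"
      unfolding restrict sum_distrib_left ..
    also have "\<dots> = c\<^sup>2 / 2 * (\<kappa>\<^sup>2 * (b - a))"
      using sum_Suc_diff'[OF pq(1), of t] pq by (simp add: v_def power_mult_distrib)
    finally show ?thesis by (simp add: normalized)
  qed
  \<comment> \<open>The one-dimensional densities multiply to the global one: the linear terms
    telescope to \<open>c * X w\<close>, and the quadratic terms add up to
    \<open>c\<^sup>2 / 2\<close> by \<open>normalized\<close>.\<close>
  ultimately have density: "ennreal (exp (c * X w - c\<^sup>2 / 2)) =
      (\<Prod>i<m. ennreal (exp (d i * \<Delta> i w - (d i)\<^sup>2 * v i / 2)))" for w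
    by (simp add: prod_ennreal exp_sum[symmetric] sum_subtractf)
  have "(\<integral>\<^sup>+w. (\<Prod>i<m. indicator (B i) (\<Delta> i (w + c *\<^sub>R \<sigma>))) \<partial>\<gamma>) =
      (\<integral>\<^sup>+w. (\<Prod>i<m. indicator (B i) (\<Delta> i w + d i * v i)) \<partial>\<gamma>)"
    by (intro nn_integral_cong prod.cong refl) (simp add: \<Delta>_shift)
  also have "\<dots> = (\<Prod>i<m. \<integral>\<^sup>+w. indicator (B i) (\<Delta> i w + d i * v i) \<partial>\<gamma>)"
    using B by (intro indep_vars_nn_integral indep_vars_compose2[OF indep]) auto
  also have "\<dots> = (\<Prod>i<m. \<integral>\<^sup>+w. indicator (B i) (\<Delta> i w) *
      ennreal (exp (d i * \<Delta> i w - (d i)\<^sup>2 * v i / 2)) \<partial>\<gamma>)"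
    using B by (intro prod.cong refl normal_cameron_martin dist v) auto
  also have "\<dots> = (\<integral>\<^sup>+w. (\<Prod>i<m. indicator (B i) (\<Delta> i w) *
      ennreal (exp (d i * \<Delta> i w - (d i)\<^sup>2 * v i / 2))) \<partial>\<gamma>)"
    using B by (intro indep_vars_nn_integral[symmetric] indep_vars_compose2[OF indep]) auto
  also have "\<dots> = (\<integral>\<^sup>+w. (\<Prod>i<m. indicator (B i) (\<Delta> i w)) *
      ennreal (exp (c * X w - c\<^sup>2 / 2)) \<partial>\<gamma>)"
    by (simp add: density prod.distrib)
  finally show ?thesis .
qed

section \<open>Cylinder sets and the law of the shifted path\<close>

definition cylinder :: "real set \<Rightarrow> (real \<Rightarrow> real set) \<Rightarrow> path set" where
  "cylinder J B = {w \<in> paths. \<forall>u\<in>J. apply_bcontfun w u \<in> B u}"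

abbreviation cylinders :: "path set set" where
  "cylinders \<equiv> {cylinder J B | J B. finite J \<and> J \<subseteq> {0..1} \<and> (\<forall>u. B u \<in> sets borel)}"

lemma Int_stable_cylinders: "Int_stable cylinders"
proof (rule Int_stableI)
  fix A A' assume "A \<in> cylinders" "A' \<in> cylinders"
  then obtain J B J' B' where *: "A = cylinder J B" "finite J" "J \<subseteq> {0..1}" "\<forall>u. B u \<in> sets borel"
    "A' = cylinder J' B'" "finite J'" "J' \<subseteq> {0..1}" "\<forall>u. B' u \<in> sets borel" by blast
  \<comment> \<open>Taking \<open>UNIV\<close> at times outside a base lets both families of
    constraints live on the union of the two bases.\<close>
  let ?B = "\<lambda>u. (if u \<in> J then B u else UNIV) \<inter> (if u \<in> J' then B' u else UNIV)"
  have "A \<inter> A' = cylinder (J \<union> J') ?B"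
    by (auto simp: * cylinder_def)
  moreover have "\<forall>u. ?B u \<in> sets borel" using * by auto
  ultimately show "A \<inter> A' \<in> cylinders"
    using *(2,3,6,7) by blast
qed

lemma cylinder_measurable:
  assumes "finite J" "J \<subseteq> {0..1}" "\<forall>u. B u \<in> sets borel"
  shows "cylinder J B \<in> sets N"
proof -
  have "{w \<in> space N. \<forall>u\<in>J. apply_bcontfun w u \<in> B u} \<in> sets N"
  proof (rule sets.sets_Collect_finite_All[OF _ assms(1)])
    fix u assume "u \<in> J"
    then have "(\<lambda>w. apply_bcontfun w u) \<in> borel_measurable N"
      using assms(2) by (intro measurable_eval_nat_filtration) auto
    from measurable_sets[OF this, of "B u"] show "{w \<in> space N. apply_bcontfun w u \<in> B u} \<in> sets N"
      using assms(3) by (simp add: vimage_def Int_def conj_commute)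
  qed
  then show ?thesis by (simp add: cylinder_def)
qed

lemma sets_N_cylinders: "sets N = sigma_sets paths cylinders"
proof (rule antisym)
  show "sets N \<subseteq> sigma_sets paths cylinders"
    unfolding sets_nat_filtration
  proof (rule sigma_sets_mono', rule subsetI)
    fix A assume "A \<in> {(\<lambda>w. apply_bcontfun w u) -` B \<inter> paths | u B.
      0 \<le> u \<and> u \<le> 1 \<and> u \<le> 1 \<and> B \<in> sets borel}"
    then obtain u B where u: "0 \<le> u" "u \<le> 1" "B \<in> sets borel"
      and "A = (\<lambda>w. apply_bcontfun w u) -` B \<inter> paths" by blast
    then have "A = cylinder {u} (\<lambda>_. B)" by (auto simp: cylinder_def)
    moreover have "finite {u}" "{u} \<subseteq> {0..1}" "\<forall>v::real. B \<in> sets borel" using u by auto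
    ultimately show "A \<in> cylinders" by blast
  qed
  have "cylinders \<subseteq> sets N" using cylinder_measurable by blast
  then show "sigma_sets paths cylinders \<subseteq> sets N"
    using sets.sigma_sets_subset[of cylinders N] by simp
qed

text \<open>The increments over a partition determine all cylinder sets based on its points, and
  their joint laws under the two measures agree on rectangles.\<close>

lemma cameron_martin_shift:
  "distr \<gamma> N (\<lambda>w. w + c *\<^sub>R \<sigma>) =
    distr (density \<gamma> (\<lambda>w. ennreal (exp (c * X w - c\<^sup>2 / 2)))) N (\<lambda>w. w)"
  (is "?\<mu> = ?\<nu>")
proof (rule measure_eqI_generator_eq[OF Int_stable_cylinders])
  show "cylinders \<subseteq> Pow paths" by (auto simp: cylinder_def)
  show "sets ?\<mu> = sigma_sets paths cylinders" "sets ?\<nu> = sigma_sets paths cylinders"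
    by (simp_all add: sets_N_cylinders)
  have "paths \<in> cylinders"
    by (intro CollectI exI[of _ "{}"] exI[of _ "\<lambda>_. UNIV"]) (simp add: cylinder_def)
  then show "range (\<lambda>_::nat. paths) \<subseteq> cylinders" by (intro image_subsetI)
  interpret \<mu>: prob_space ?\<mu> by (rule prob_space_distr[OF measurable_shift])
  show "emeasure ?\<mu> paths \<noteq> \<infinity>"
    unfolding infinity_ennreal_def by (rule \<mu>.emeasure_finite)
  fix A assume "A \<in> cylinders"
  then obtain J B where J: "A = cylinder J B" "finite J" "J \<subseteq> {0..1}"
    and B: "\<forall>u. B u \<in> sets borel" by blast
  \<comment> \<open>The points \<open>a\<close> and \<open>b\<close> are added so that no increment
    straddles a kink of the ramp, and 0 so that increments can be summed up from a time where all
    paths agree.\<close>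
  define K where "K = J \<union> {0, a, b, 1}"
  have K: "finite K" "K \<noteq> {}" "K \<subseteq> {0..1}" "J \<subseteq> K" "0 \<in> K" "a \<in> K" "b \<in> K"
    using J ab by (auto simp: K_def)
  obtain m t where t: "\<And>i. i < m \<Longrightarrow> t i < t (Suc i)" and Kt: "K = t ` {..m}"
    using sorted_enumeration[OF K(1,2)] by blast
  have range: "0 \<le> t i" "t i \<le> 1" if "i \<le> m" for i
    using K(3) that unfolding Kt by auto
  have mono: "t i \<le> t j" if "i \<le> j" "j \<le> m" for i j
    using that
  proof (induction j rule: dec_induct)
    case (step n)
    then show ?case using t[of n] by auto
  qed simp
  have t0: "t 0 = 0"
  proof -
    obtain i where "i \<le> m" "t i = 0" using K(5) unfolding Kt by auto
    then show ?thesis using mono[of 0 i] range(1)[of 0] by simp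
  qed
  obtain p q where pq: "p \<le> m" "t p = a" "q \<le> m" "t q = b"
    using K(6,7) unfolding Kt by auto
  have "p \<le> q" using mono[of q p] pq ab by (meson linorder_not_less nat_le_linear)
  define \<Delta> where "\<Delta> i w = apply_bcontfun w (t (Suc i)) - apply_bcontfun w (t i)" for i and w :: path
  define V where "V w = (\<lambda>i\<in>{..<m}. \<Delta> i w)" for w
  define P :: "(nat \<Rightarrow> real) measure" where "P = PiM {..<m} (\<lambda>_. borel)"
  have \<Delta> [measurable]: "\<Delta> i \<in> borel_measurable N" if "i < m" for i
    unfolding \<Delta>_def using range[of i] range[of "Suc i"] that
    by (intro borel_measurable_diff measurable_eval_nat_filtration) auto
  have V [measurable]: "V \<in> measurable N P"
    unfolding V_def P_def by (rule measurable_restrict) (simp add: \<Delta>)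
  have rect_indicator: "indicator (Pi\<^sub>E {..<m} R) (V w) =
      (\<Prod>i<m. indicator (R i) (\<Delta> i w) :: ennreal)" for R w
  proof (cases "\<forall>i<m. \<Delta> i w \<in> R i")
    case True
    then have "V w \<in> Pi\<^sub>E {..<m} R" by (auto simp: V_def)
    then show ?thesis using True by simp
  next
    case False
    then have "V w \<notin> Pi\<^sub>E {..<m} R" by (auto simp: V_def PiE_iff)
    moreover have "(\<Prod>i<m. indicator (R i) (\<Delta> i w) :: ennreal) = 0"
      using False by (intro prod_zero) (auto simp: indicator_def)
    ultimately show ?thesis by simp
  qed
  have rect: "emeasure (distr Q P V) (Pi\<^sub>E {..<m} R) =
      (\<integral>\<^sup>+w. (\<Prod>i<m. indicator (R i) (\<Delta> i w)) \<partial>Q)"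
    if "\<And>i. i < m \<Longrightarrow> R i \<in> sets borel" "sets Q = sets N" for Q R
  proof -
    have R: "Pi\<^sub>E {..<m} R \<in> sets P" unfolding P_def using that by (intro sets_PiM_I_finite) auto
    have VQ: "V \<in> measurable Q P" using V measurable_cong_sets[OF that(2) refl] by blast
    have "emeasure (distr Q P V) (Pi\<^sub>E {..<m} R) = (\<integral>\<^sup>+y. indicator (Pi\<^sub>E {..<m} R) y \<partial>distr Q P V)"
      using R by simp
    also have "\<dots> = (\<integral>\<^sup>+w. indicator (Pi\<^sub>E {..<m} R) (V w) \<partial>Q)"
      using R by (intro nn_integral_distr[OF VQ]) simp
    finally show ?thesis by (simp add: rect_indicator)
  qed
  have "distr ?\<mu> P V = distr ?\<nu> P V"
  proof (rule measure_eqI_PiM_finite)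
    show "finite {..<m}" by simp
    show "sets (distr ?\<mu> P V) = PiM {..<m} (\<lambda>_. borel)" "sets (distr ?\<nu> P V) = PiM {..<m} (\<lambda>_. borel)"
      by (simp_all add: P_def)
    show "range (\<lambda>_::nat. Pi\<^sub>E {..<m} (\<lambda>_. UNIV)) \<subseteq> prod_algebra {..<m} (\<lambda>_. borel :: real measure)"
      by (auto intro!: prod_algebraI_finite)
    show "(\<Union>_::nat. Pi\<^sub>E {..<m} (\<lambda>_. UNIV)) = space (PiM {..<m} (\<lambda>_. borel :: real measure))"
      by (simp add: space_PiM)
    interpret V\<mu>: prob_space "distr ?\<mu> P V" by (rule \<mu>.prob_space_distr) simp
    show "emeasure (distr ?\<mu> P V) (Pi\<^sub>E {..<m} (\<lambda>_. UNIV)) \<noteq> \<infinity>" by simp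
    fix R :: "nat \<Rightarrow> real set" assume "\<And>i. i \<in> {..<m} \<Longrightarrow> R i \<in> sets borel"
    then have R: "\<And>i. i < m \<Longrightarrow> R i \<in> sets borel" by simp
    have meas: "(\<lambda>w. \<Prod>i<m. indicator (R i) (\<Delta> i w) :: ennreal) \<in> borel_measurable N"
      using R by (intro borel_measurable_prod_ennreal) (auto intro!: measurable_compose[OF \<Delta>])
    have "emeasure (distr ?\<mu> P V) (Pi\<^sub>E {..<m} R) =
        (\<integral>\<^sup>+w. (\<Prod>i<m. indicator (R i) (\<Delta> i (w + c *\<^sub>R \<sigma>))) \<partial>\<gamma>)"
      using meas by (simp add: rect[OF R] nn_integral_distr[OF measurable_shift])
    also have "\<dots> = (\<integral>\<^sup>+w. (\<Prod>i<m. indicator (R i) (\<Delta> i w)) *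
        ennreal (exp (c * X w - c\<^sup>2 / 2)) \<partial>\<gamma>)"
      unfolding \<Delta>_def
      by (rule cameron_martin_rectangle[OF t range(1) range(2) \<open>p \<le> q\<close> pq(3) pq(2) pq(4) R]) auto
    also have "\<dots> = emeasure (distr ?\<nu> P V) (Pi\<^sub>E {..<m} R)"
      using meas measurable_compose[OF measurable_id meas]
      by (simp add: rect[OF R] nn_integral_distr nn_integral_density mult.commute)
    finally show "emeasure (distr ?\<mu> P V) (Pi\<^sub>E {..<m} R) = emeasure (distr ?\<nu> P V) (Pi\<^sub>E {..<m} R)" .
  qed
  moreover have push: "emeasure Q A = emeasure (distr Q P V) C"
    if "sets Q = sets N" "A = V -` C \<inter> paths" "C \<in> sets P" for Q C
  proof -
    have VQ: "V \<in> measurable Q P" using V measurable_cong_sets[OF that(1) refl] by blast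
    have "space Q = paths" using sets_eq_imp_space_eq[OF that(1)] by simp
    then show ?thesis using emeasure_distr[OF VQ that(3)] that(2) by simp
  qed
  \<comment> \<open>Paths vanish at \<open>t 0 = 0\<close>, so each value at a time of
    \<open>J\<close> is a partial sum of increments and the cylinder is a preimage under
    \<open>V\<close>.\<close>
  moreover obtain C where C: "C \<in> sets P" "A = V -` C \<inter> paths"
  proof -
    have "\<forall>u\<in>J. \<exists>i. i \<le> m \<and> t i = u"
      using K(4) unfolding Kt by auto
    from bchoice[OF this] obtain idx where idx: "\<And>u. u \<in> J \<Longrightarrow> idx u \<le> m" "\<And>u. u \<in> J \<Longrightarrow> t (idx u) = u"
      by blast
    have tele: "(\<Sum>i<idx u. V w i) = apply_bcontfun w u" if "u \<in> J" "w \<in> paths" for u w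
    proof -
      have "(\<Sum>i<idx u. V w i) = (\<Sum>i<idx u. \<Delta> i w)"
        using idx(1)[OF that(1)] by (intro sum.cong) (auto simp: V_def)
      also have "\<dots> = apply_bcontfun w (t (idx u)) - apply_bcontfun w (t 0)"
        unfolding \<Delta>_def by (rule sum_lessThan_telescope)
      finally show ?thesis using idx(2)[OF that(1)] t0 path_at_0[OF that(2)] by simp
    qed
    let ?C = "{y \<in> space P. \<forall>u\<in>J. (\<Sum>i<idx u. y i) \<in> B u}"
    have "?C \<in> sets P"
    proof (rule sets.sets_Collect_finite_All[OF _ J(2)])
      fix u assume "u \<in> J"
      then have "(\<lambda>y. \<Sum>i<idx u. y i) \<in> borel_measurable P"
        unfolding P_def using idx(1)[of u]
        by (intro borel_measurable_sum measurable_component_singleton) simp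
      from measurable_sets[OF this, of "B u"]
      show "{y \<in> space P. (\<Sum>i<idx u. y i) \<in> B u} \<in> sets P"
        using B by (simp add: vimage_def Int_def conj_commute)
    qed
    moreover have "A = V -` ?C \<inter> paths"
      unfolding J cylinder_def
    proof (intro set_eqI iffI)
      fix w assume "w \<in> {w \<in> paths. \<forall>u\<in>J. apply_bcontfun w u \<in> B u}"
      then show "w \<in> V -` ?C \<inter> paths"
        using measurable_space[OF V, of w] by (simp add: tele)
    next
      fix w assume "w \<in> V -` ?C \<inter> paths"
      then have "w \<in> paths" "\<forall>u\<in>J. (\<Sum>i<idx u. V w i) \<in> B u" by auto
      then show "w \<in> {w \<in> paths. \<forall>u\<in>J. apply_bcontfun w u \<in> B u}"
        by (simp add: tele)
    qed
    ultimately show ?thesis by (rule that)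
  qed
  ultimately show "emeasure ?\<mu> A = emeasure ?\<nu> A"
    using push[OF _ C(2,1), of ?\<mu>] push[OF _ C(2,1), of ?\<nu>] by simp
qed simp

lemma nn_integral_cameron_martin:
  assumes [measurable]: "f \<in> borel_measurable N"
  shows "(\<integral>\<^sup>+w. f (w + c *\<^sub>R \<sigma>) \<partial>\<gamma>) = (\<integral>\<^sup>+w. f w * ennreal (exp (c * X w - c\<^sup>2 / 2)) \<partial>\<gamma>)"
proof -
  have "(\<integral>\<^sup>+w. f (w + c *\<^sub>R \<sigma>) \<partial>\<gamma>) = (\<integral>\<^sup>+w. f w \<partial>distr \<gamma> N (\<lambda>w. w + c *\<^sub>R \<sigma>))"
    by (simp add: nn_integral_distr[OF measurable_shift])
  also have "\<dots> = (\<integral>\<^sup>+w. f w * ennreal (exp (c * X w - c\<^sup>2 / 2)) \<partial>\<gamma>)"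
    unfolding cameron_martin_shift using measurable_compose[OF measurable_id assms]
    by (simp add: nn_integral_distr nn_integral_density mult.commute)
  finally show ?thesis .
qed

end

section \<open>Random shifts\<close>

lemma std_normal_density_shift:
  "std_normal_density (y - c) = std_normal_density y * exp (c * y - c\<^sup>2 / 2)"
proof -
  have "- (y - c)\<^sup>2 / 2 = - y\<^sup>2 / 2 + (c * y - c\<^sup>2 / 2)"
    by (simp add: field_simps power2_eq_square)
  then have "exp (- (y - c)\<^sup>2 / 2) = exp (- y\<^sup>2 / 2) * exp (c * y - c\<^sup>2 / 2)"
    by (simp only: exp_add)
  then show ?thesis by (simp add: normal_density_def)
qed

lemma nn_integral_translate:
  fixes f :: "real \<Rightarrow> ennreal"
  assumes "f \<in> borel_measurable borel"
  shows "(\<integral>\<^sup>+y. f (y + t) \<partial>lborel) = (\<integral>\<^sup>+y. f y \<partial>lborel)"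
  using nn_integral_real_affine[OF assms, of 1 t] by (simp add: add.commute)

lemma measurable_pair_compose:
  assumes "(\<lambda>(v, y). \<Psi> v y) \<in> measurable (A \<Otimes>\<^sub>M B) C"
    and "f \<in> measurable M A" "g \<in> measurable M B"
  shows "(\<lambda>x. \<Psi> (f x) (g x)) \<in> measurable M C"
  using measurable_compose[OF measurable_Pair[OF assms(2,3)] assms(1)] by simp

context haar_direction
begin

abbreviation \<phi> :: "real \<Rightarrow> ennreal" where
  "\<phi> y \<equiv> ennreal (std_normal_density y)"

lemma nn_integral_\<phi>: "(\<integral>\<^sup>+y. \<phi> y \<partial>lborel) = 1"
proof -
  interpret S: prob_space "density lborel \<phi>" by (rule prob_space_normal_density) simp
  show ?thesis using S.emeasure_space_1 by (simp add: emeasure_density)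
qed

text \<open>\<open>X\<close> is standard normal and independent of \<open>T\<close>: average the Cameron-Martin formula over the
  shift \<open>c\<close> with the Gaussian weight, substitute \<open>y = X + c\<close>, and use that \<open>T\<close> is
  invariant under the shift.\<close>

lemma nn_integral_disintegration:
  assumes [measurable]: "(\<lambda>(v, y). \<Psi> v y) \<in> borel_measurable (N \<Otimes>\<^sub>M borel)"
  shows "(\<integral>\<^sup>+w. \<Psi> (T w) (X w) \<partial>\<gamma>) = (\<integral>\<^sup>+w. (\<integral>\<^sup>+y. \<Psi> (T w) y * \<phi> y \<partial>lborel) \<partial>\<gamma>)"
proof -
  interpret pair_sigma_finite \<gamma> lborel ..
  note \<Psi> = measurable_pair_compose[OF assms]
  have fixed: "(\<integral>\<^sup>+w. \<Psi> (T w) (X w) \<partial>\<gamma>) =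
      (\<integral>\<^sup>+w. \<Psi> (T w) (X w + c) * ennreal (exp (- c * X w - c\<^sup>2 / 2)) \<partial>\<gamma>)" for c
  proof -
    \<comment> \<open>The exponential factor is the reciprocal of the Cameron-Martin density for the
      shift \<open>c\<close>, so the density cancels on one side and the factor appears shifted on
      the other.\<close>
    let ?f = "\<lambda>w. \<Psi> (T w) (X w) * ennreal (exp (- c * X w + c\<^sup>2 / 2))"
    have exponent: "- c * (X w + c) + c\<^sup>2 / 2 = - c * X w - c\<^sup>2 / 2" for w
      by (simp add: algebra_simps power2_eq_square)
    have "?f \<in> borel_measurable N" by (intro borel_measurable_times_ennreal \<Psi>) simp_all
    from nn_integral_cameron_martin[OF this, of c]
    have "(\<integral>\<^sup>+w. \<Psi> (T w) (X w + c) * ennreal (exp (- c * (X w + c) + c\<^sup>2 / 2)) \<partial>\<gamma>) =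
        (\<integral>\<^sup>+w. ?f w * ennreal (exp (c * X w - c\<^sup>2 / 2)) \<partial>\<gamma>)"
      by (simp add: T_shift X_shift)
    also have "\<dots> = (\<integral>\<^sup>+w. \<Psi> (T w) (X w) \<partial>\<gamma>)"
      by (simp add: mult.assoc ennreal_mult'[symmetric] exp_add[symmetric])
    finally show ?thesis by (simp only: exponent)
  qed
  have "(\<integral>\<^sup>+w. \<Psi> (T w) (X w) \<partial>\<gamma>) = (\<integral>\<^sup>+c. (\<integral>\<^sup>+w. \<Psi> (T w) (X w) \<partial>\<gamma>) * \<phi> c \<partial>lborel)"
    by (simp add: nn_integral_cmult nn_integral_\<phi>)
  also have "\<dots> = (\<integral>\<^sup>+c. (\<integral>\<^sup>+w. \<Psi> (T w) (X w + c) * ennreal (exp (- c * X w - c\<^sup>2 / 2)) * \<phi> c \<partial>\<gamma>) \<partial>lborel)"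
  proof (rule nn_integral_cong)
    fix c
    show "(\<integral>\<^sup>+w. \<Psi> (T w) (X w) \<partial>\<gamma>) * \<phi> c =
        (\<integral>\<^sup>+w. \<Psi> (T w) (X w + c) * ennreal (exp (- c * X w - c\<^sup>2 / 2)) * \<phi> c \<partial>\<gamma>)"
      by (subst fixed[of c], subst nn_integral_multc) (auto intro!: borel_measurable_times_ennreal \<Psi>)
  qed
  also have "\<dots> = (\<integral>\<^sup>+w. (\<integral>\<^sup>+c. \<Psi> (T w) (X w + c) * ennreal (exp (- c * X w - c\<^sup>2 / 2)) * \<phi> c \<partial>lborel) \<partial>\<gamma>)"
    by (rule Fubini') (auto simp: case_prod_beta' intro!: borel_measurable_times_ennreal \<Psi>)
  also have "\<dots> = (\<integral>\<^sup>+w. (\<integral>\<^sup>+y. \<Psi> (T w) y * ennreal (exp (y * X w - y\<^sup>2 / 2)) * \<phi> y \<partial>lborel) \<partial>\<gamma>)"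
  proof (rule nn_integral_cong)
    fix w assume w: "w \<in> space \<gamma>"
    let ?g = "\<lambda>y. \<Psi> (T w) y * (ennreal (exp (- (y - X w) * X w - (y - X w)\<^sup>2 / 2)) * \<phi> (y - X w))"
    have Tw: "T w \<in> space N" using w T_in_paths by simp
    have "(\<integral>\<^sup>+c. \<Psi> (T w) (X w + c) * ennreal (exp (- c * X w - c\<^sup>2 / 2)) * \<phi> c \<partial>lborel) =
        (\<integral>\<^sup>+c. ?g (c + X w) \<partial>lborel)"
      by (simp add: mult.assoc add.commute)
    also have "\<dots> = (\<integral>\<^sup>+y. ?g y \<partial>lborel)"
      using Tw by (intro nn_integral_translate borel_measurable_times_ennreal \<Psi>) simp_all
    also have "\<dots> = (\<integral>\<^sup>+y. \<Psi> (T w) y * ennreal (exp (y * X w - y\<^sup>2 / 2)) * \<phi> y \<partial>lborel)"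
    proof (rule nn_integral_cong)
      fix y
      \<comment> \<open>Completing the square: for \<open>c = y - X w\<close> the weight times the
        Gaussian density at \<open>c\<close> equals the Cameron-Martin density for the constant
        shift \<open>y\<close> times the Gaussian density at \<open>y\<close>.\<close>
      have "- (y - X w) * X w - (y - X w)\<^sup>2 / 2 + (X w * y - (X w)\<^sup>2 / 2) = y * X w - y\<^sup>2 / 2"
        by (simp add: field_simps power2_eq_square)
      then have exps: "exp (- (y - X w) * X w - (y - X w)\<^sup>2 / 2) * exp (X w * y - (X w)\<^sup>2 / 2) =
          exp (y * X w - y\<^sup>2 / 2)"
        by (simp only: exp_add[symmetric])
      have "exp (- (y - X w) * X w - (y - X w)\<^sup>2 / 2) * std_normal_density (y - X w) =
          exp (y * X w - y\<^sup>2 / 2) * std_normal_density y"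
        unfolding std_normal_density_shift mult.left_commute[of "exp _" "std_normal_density _"] exps
        by (rule mult.commute)
      then show "?g y = \<Psi> (T w) y * ennreal (exp (y * X w - y\<^sup>2 / 2)) * \<phi> y"
        by (simp add: mult.assoc ennreal_mult'[symmetric])
    qed
    finally show "(\<integral>\<^sup>+c. \<Psi> (T w) (X w + c) * ennreal (exp (- c * X w - c\<^sup>2 / 2)) * \<phi> c \<partial>lborel) =
      (\<integral>\<^sup>+y. \<Psi> (T w) y * ennreal (exp (y * X w - y\<^sup>2 / 2)) * \<phi> y \<partial>lborel)" .
  qed
  also have "\<dots> = (\<integral>\<^sup>+y. (\<integral>\<^sup>+w. \<Psi> (T w) y * ennreal (exp (y * X w - y\<^sup>2 / 2)) * \<phi> y \<partial>\<gamma>) \<partial>lborel)"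
    by (rule Fubini'[symmetric]) (auto simp: case_prod_beta' intro!: borel_measurable_times_ennreal \<Psi>)
  also have "\<dots> = (\<integral>\<^sup>+y. (\<integral>\<^sup>+w. \<Psi> (T w) y * \<phi> y \<partial>\<gamma>) \<partial>lborel)"
  proof (rule nn_integral_cong)
    fix y :: real
    \<comment> \<open>For fixed \<open>y\<close> the remaining integrand depends on
      \<open>T w\<close> alone, which the shift by \<open>y\<close> preserves. The Cameron-Martin
      formula, read backwards, therefore removes the exponential.\<close>
    have "(\<lambda>w. \<Psi> (T w) y) \<in> borel_measurable N" by (intro \<Psi>) simp_all
    from nn_integral_cameron_martin[OF this, of y]
    show "(\<integral>\<^sup>+w. \<Psi> (T w) y * ennreal (exp (y * X w - y\<^sup>2 / 2)) * \<phi> y \<partial>\<gamma>) =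
        (\<integral>\<^sup>+w. \<Psi> (T w) y * \<phi> y \<partial>\<gamma>)"
      by (simp add: T_shift nn_integral_multc \<Psi>)
  qed
  also have "\<dots> = (\<integral>\<^sup>+w. (\<integral>\<^sup>+y. \<Psi> (T w) y * \<phi> y \<partial>lborel) \<partial>\<gamma>)"
    by (rule Fubini') (auto simp: case_prod_beta' intro!: borel_measurable_times_ennreal \<Psi>)
  finally show ?thesis .
qed

text \<open>The shift is random, so the formula for constant shifts does not apply directly. After
  disintegration \<open>T w\<close> is frozen, \<open>\<zeta> (T w)\<close> becomes a constant, and
  only a translation in the Gaussian variable \<open>y\<close> is left.\<close>

lemma nn_integral_random_shift:
  assumes \<Psi>': "(\<lambda>(v, y). \<Psi> v y) \<in> borel_measurable (N \<Otimes>\<^sub>M borel)"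
    and \<zeta> [measurable]: "\<zeta> \<in> borel_measurable N"
  shows "(\<integral>\<^sup>+w. \<Psi> (T w) (X w + \<zeta> (T w)) \<partial>\<gamma>) =
    (\<integral>\<^sup>+w. \<Psi> (T w) (X w) * ennreal (exp (\<zeta> (T w) * X w - (\<zeta> (T w))\<^sup>2 / 2)) \<partial>\<gamma>)"
proof -
  note \<Psi> = measurable_pair_compose[OF \<Psi>']
  have \<zeta>_fst: "(\<lambda>p. \<zeta> (fst p)) \<in> borel_measurable (N \<Otimes>\<^sub>M borel)"
    by (rule measurable_compose[OF measurable_fst \<zeta>])
  have "(\<integral>\<^sup>+w. \<Psi> (T w) (X w + \<zeta> (T w)) \<partial>\<gamma>) =
      (\<integral>\<^sup>+w. (\<integral>\<^sup>+y. \<Psi> (T w) (y + \<zeta> (T w)) * \<phi> y \<partial>lborel) \<partial>\<gamma>)"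
    by (rule nn_integral_disintegration)
       (auto simp: case_prod_beta' intro!: \<Psi> borel_measurable_add \<zeta>_fst)
  also have "\<dots> = (\<integral>\<^sup>+w. (\<integral>\<^sup>+y. \<Psi> (T w) y *
      ennreal (exp (\<zeta> (T w) * y - (\<zeta> (T w))\<^sup>2 / 2)) * \<phi> y \<partial>lborel) \<partial>\<gamma>)"
  proof (rule nn_integral_cong)
    fix w assume w: "w \<in> space \<gamma>"
    have Tw: "T w \<in> space N" using w T_in_paths by simp
    let ?g = "\<lambda>y. \<Psi> (T w) y * \<phi> (y - \<zeta> (T w))"
    have "(\<integral>\<^sup>+y. ?g (y + \<zeta> (T w)) \<partial>lborel) = (\<integral>\<^sup>+y. ?g y \<partial>lborel)"
      using Tw by (intro nn_integral_translate borel_measurable_times_ennreal \<Psi>) simp_all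
    then show "(\<integral>\<^sup>+y. \<Psi> (T w) (y + \<zeta> (T w)) * \<phi> y \<partial>lborel) = (\<integral>\<^sup>+y. \<Psi> (T w) y *
      ennreal (exp (\<zeta> (T w) * y - (\<zeta> (T w))\<^sup>2 / 2)) * \<phi> y \<partial>lborel)"
      by (simp add: std_normal_density_shift ennreal_mult' mult_ac)
  qed
  also have "\<dots> = (\<integral>\<^sup>+w. \<Psi> (T w) (X w) * ennreal (exp (\<zeta> (T w) * X w - (\<zeta> (T w))\<^sup>2 / 2)) \<partial>\<gamma>)"
    by (rule nn_integral_disintegration[symmetric])
       (auto simp: case_prod_beta'
         intro!: borel_measurable_times_ennreal \<Psi> measurable_compose[OF _ measurable_ennreal]
           borel_measurable_exp borel_measurable_diff borel_measurable_divide borel_measurable_power \<zeta>_fst)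
  finally show ?thesis .
qed

text \<open>Passing from nonnegative integrals to measures makes the shift formula available for
  real integrands without any bound on \<open>\<zeta>\<close>.\<close>

lemma distr_random_shift:
  assumes \<zeta> [measurable]: "\<zeta> \<in> borel_measurable N"
  shows "distr \<gamma> (N \<Otimes>\<^sub>M borel) (\<lambda>w. (T w, X w + \<zeta> (T w))) =
    density (distr \<gamma> (N \<Otimes>\<^sub>M borel) (\<lambda>w. (T w, X w)))
      (\<lambda>p. ennreal (exp (\<zeta> (fst p) * snd p - (\<zeta> (fst p))\<^sup>2 / 2)))"
proof (rule measure_eqI)
  have \<zeta>_fst [measurable]: "(\<lambda>p. \<zeta> (fst p)) \<in> borel_measurable (N \<Otimes>\<^sub>M borel)"
    by (rule measurable_compose[OF measurable_fst \<zeta>])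
  have \<zeta>_T [measurable]: "(\<lambda>w. \<zeta> (T w)) \<in> borel_measurable \<gamma>"
    by (rule measurable_compose[OF measurable_T \<zeta>])
  have dens [measurable]: "(\<lambda>p. ennreal (exp (\<zeta> (fst p) * snd p - (\<zeta> (fst p))\<^sup>2 / 2)))
      \<in> borel_measurable (N \<Otimes>\<^sub>M borel)"
    by measurable
  fix A assume "A \<in> sets (distr \<gamma> (N \<Otimes>\<^sub>M borel) (\<lambda>w. (T w, X w + \<zeta> (T w))))"
  then have A [measurable]: "A \<in> sets (N \<Otimes>\<^sub>M borel)" by simp
  have "emeasure (distr \<gamma> (N \<Otimes>\<^sub>M borel) (\<lambda>w. (T w, X w + \<zeta> (T w)))) A =
      (\<integral>\<^sup>+p. indicator A p \<partial>distr \<gamma> (N \<Otimes>\<^sub>M borel) (\<lambda>w. (T w, X w + \<zeta> (T w))))"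
    using A by simp
  also have "\<dots> = (\<integral>\<^sup>+w. indicator A (T w, X w + \<zeta> (T w)) \<partial>\<gamma>)"
    by (rule nn_integral_distr) measurable
  also have "\<dots> = (\<integral>\<^sup>+w. indicator A (T w, X w) *
      ennreal (exp (\<zeta> (T w) * X w - (\<zeta> (T w))\<^sup>2 / 2)) \<partial>\<gamma>)"
    by (rule nn_integral_random_shift[where \<Psi> = "\<lambda>v y. indicator A (v, y)"]) (simp_all add: \<zeta>)
  also have "\<dots> = (\<integral>\<^sup>+p. ennreal (exp (\<zeta> (fst p) * snd p - (\<zeta> (fst p))\<^sup>2 / 2)) * indicator A p
      \<partial>distr \<gamma> (N \<Otimes>\<^sub>M borel) (\<lambda>w. (T w, X w)))"
    by (subst nn_integral_distr) (simp_all add: mult.commute)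
  also have "\<dots> = emeasure (density (distr \<gamma> (N \<Otimes>\<^sub>M borel) (\<lambda>w. (T w, X w)))
      (\<lambda>p. ennreal (exp (\<zeta> (fst p) * snd p - (\<zeta> (fst p))\<^sup>2 / 2)))) A"
    by (rule emeasure_density[symmetric]) simp_all
  finally show "emeasure (distr \<gamma> (N \<Otimes>\<^sub>M borel) (\<lambda>w. (T w, X w + \<zeta> (T w)))) A =
     emeasure (density (distr \<gamma> (N \<Otimes>\<^sub>M borel) (\<lambda>w. (T w, X w)))
      (\<lambda>p. ennreal (exp (\<zeta> (fst p) * snd p - (\<zeta> (fst p))\<^sup>2 / 2)))) A" .
qed simp

text \<open>Both claims are change of variables for the same pair of measures. The second holds in
  all cases, the integral being 0 by convention when either side, hence by the first claim each
  side, fails to be integrable.\<close>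

lemma integral_random_shift:
  fixes f :: "path \<times> real \<Rightarrow> real"
  assumes \<zeta> [measurable]: "\<zeta> \<in> borel_measurable N" and f [measurable]: "f \<in> borel_measurable (N \<Otimes>\<^sub>M borel)"
  shows "integrable \<gamma> (\<lambda>w. f (T w, X w + \<zeta> (T w))) \<longleftrightarrow>
      integrable \<gamma> (\<lambda>w. f (T w, X w) * exp (\<zeta> (T w) * X w - (\<zeta> (T w))\<^sup>2 / 2))"
    and "(\<integral>w. f (T w, X w + \<zeta> (T w)) \<partial>\<gamma>) =
      (\<integral>w. f (T w, X w) * exp (\<zeta> (T w) * X w - (\<zeta> (T w))\<^sup>2 / 2) \<partial>\<gamma>)"
proof -
  have \<zeta>_fst [measurable]: "(\<lambda>p. \<zeta> (fst p)) \<in> borel_measurable (N \<Otimes>\<^sub>M borel)"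
    by (rule measurable_compose[OF measurable_fst \<zeta>])
  have \<zeta>_T [measurable]: "(\<lambda>w. \<zeta> (T w)) \<in> borel_measurable \<gamma>"
    by (rule measurable_compose[OF measurable_T \<zeta>])
  let ?d = "\<lambda>p. exp (\<zeta> (fst p) * snd p - (\<zeta> (fst p))\<^sup>2 / 2)"
  have d [measurable]: "?d \<in> borel_measurable (N \<Otimes>\<^sub>M borel)" by measurable
  let ?Q = "distr \<gamma> (N \<Otimes>\<^sub>M borel) (\<lambda>w. (T w, X w))"
  have shift [measurable]: "(\<lambda>w. (T w, X w + \<zeta> (T w))) \<in> measurable \<gamma> (N \<Otimes>\<^sub>M borel)" by measurable
  have TX [measurable]: "(\<lambda>w. (T w, X w)) \<in> measurable \<gamma> (N \<Otimes>\<^sub>M borel)" by measurable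
  have "integrable \<gamma> (\<lambda>w. f (T w, X w + \<zeta> (T w))) \<longleftrightarrow>
      integrable (density ?Q (\<lambda>p. ennreal (?d p))) f"
    using integrable_distr_eq[OF shift f] by (simp add: distr_random_shift[OF \<zeta>])
  also have "\<dots> \<longleftrightarrow> integrable ?Q (\<lambda>p. ?d p *\<^sub>R f p)"
    by (rule integrable_density) simp_all
  also have "\<dots> \<longleftrightarrow> integrable \<gamma> (\<lambda>w. f (T w, X w) * exp (\<zeta> (T w) * X w - (\<zeta> (T w))\<^sup>2 / 2))"
    by (subst integrable_distr_eq) (simp_all add: mult.commute)
  finally show "integrable \<gamma> (\<lambda>w. f (T w, X w + \<zeta> (T w))) \<longleftrightarrow>
      integrable \<gamma> (\<lambda>w. f (T w, X w) * exp (\<zeta> (T w) * X w - (\<zeta> (T w))\<^sup>2 / 2))" .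
  have "(\<integral>w. f (T w, X w + \<zeta> (T w)) \<partial>\<gamma>) = integral\<^sup>L (density ?Q (\<lambda>p. ennreal (?d p))) f"
    using integral_distr[OF shift f] by (simp add: distr_random_shift[OF \<zeta>])
  also have "\<dots> = (\<integral>p. ?d p *\<^sub>R f p \<partial>?Q)"
    by (rule integral_density) simp_all
  also have "\<dots> = (\<integral>w. f (T w, X w) * exp (\<zeta> (T w) * X w - (\<zeta> (T w))\<^sup>2 / 2) \<partial>\<gamma>)"
    by (subst integral_distr) (simp_all add: mult.commute)
  finally show "(\<integral>w. f (T w, X w + \<zeta> (T w)) \<partial>\<gamma>) =
      (\<integral>w. f (T w, X w) * exp (\<zeta> (T w) * X w - (\<zeta> (T w))\<^sup>2 / 2) \<partial>\<gamma>)" .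
qed

end

section \<open>Wiener integrals as limits of elementary integrals\<close>

lemma tendsto_zero_if_square:
  fixes x :: "'b \<Rightarrow> real"
  assumes "((\<lambda>n. (x n)\<^sup>2) \<longlongrightarrow> 0) F"
  shows "(x \<longlongrightarrow> 0) F"
  using tendsto_real_sqrt[OF assms] by (simp add: tendsto_rabs_zero_iff)

text \<open>Mean square convergence to 0 is convergence of the squares in mean, which yields an
  almost everywhere convergent subsequence.\<close>

lemma L2_convergent_AE_subseq:
  fixes f :: "nat \<Rightarrow> 'a \<Rightarrow> real"
  assumes meas [measurable]: "\<And>n. f n \<in> borel_measurable M"
    and lim: "(\<lambda>n. \<integral>\<^sup>+x. ennreal ((f n x)\<^sup>2) \<partial>M) \<longlonglongrightarrow> 0"
  obtains r :: "nat \<Rightarrow> nat" where "strict_mono r" "AE x in M. (\<lambda>n. f (r n) x) \<longlonglongrightarrow> 0"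
proof -
  have "\<forall>\<^sub>F n in sequentially. (\<integral>\<^sup>+x. ennreal ((f n x)\<^sup>2) \<partial>M) < 1"
    using order_tendstoD(2)[OF lim, of 1] by simp
  \<comment> \<open>Finitely many of the integrals may be infinite; the sequence is cut off at
    \<open>n0\<close> so that all squares are integrable.\<close>
  then obtain n0 where n0: "\<And>n. n \<ge> n0 \<Longrightarrow> (\<integral>\<^sup>+x. ennreal ((f n x)\<^sup>2) \<partial>M) < 1"
    unfolding eventually_sequentially by blast
  let ?u = "\<lambda>n x. (f (n + n0) x)\<^sup>2"
  have int: "integrable M (?u n)" for n
  proof (rule integrableI_nonneg)
    show "(\<integral>\<^sup>+x. ennreal (?u n x) \<partial>M) < \<infinity>"
      using n0[of "n + n0"] by (simp add: order.strict_trans[OF _ ennreal_one_less_top])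
  qed auto
  have "(\<lambda>n. \<integral>\<^sup>+x. ennreal (?u n x) \<partial>M) \<longlonglongrightarrow> 0"
    using LIMSEQ_ignore_initial_segment[OF lim, of n0] .
  then have "(\<lambda>n. ennreal (\<integral>x. ?u n x \<partial>M)) \<longlonglongrightarrow> ennreal 0"
    by (simp add: nn_integral_eq_integral[OF int])
  then have "(\<lambda>n. \<integral>x. norm (?u n x) \<partial>M) \<longlonglongrightarrow> 0"
    by (simp del: ennreal_0)
  from tendsto_L1_AE_subseq[of M ?u, OF int this]
  obtain r :: "nat \<Rightarrow> nat" where r: "strict_mono r" "AE x in M. (\<lambda>n. ?u (r n) x) \<longlonglongrightarrow> 0"
    by blast
  show ?thesis
  proof (rule that[of "\<lambda>n. r n + n0"])
    show "strict_mono (\<lambda>n. r n + n0)" using r(1) by (simp add: strict_mono_def)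
    show "AE x in M. (\<lambda>n. f (r n + n0) x) \<longlonglongrightarrow> 0"
      using r(2) by eventually_elim (rule tendsto_zero_if_square)
  qed
qed

text \<open>Preimages under \<open>f\<close> and \<open>g\<close> differ only inside the null set
  where the two functions differ, and the completion contains every subset of it.\<close>

lemma measurable_completion_AE_eq:
  fixes f g :: "'a \<Rightarrow> real"
  assumes g [measurable]: "g \<in> borel_measurable M" and eq: "AE x in M. f x = g x"
  shows "f \<in> borel_measurable (completion M)"
proof (rule measurableI)
  fix B :: "real set" assume [measurable]: "B \<in> sets borel"
  have gc: "g \<in> borel_measurable (completion M)" by (rule measurable_completion[OF g])
  have [measurable]: "Measurable.pred (completion M) (\<lambda>x. f x \<noteq> g x)"
    by (rule sets_completion_AE) (use eq in simp)
  have [measurable]: "Measurable.pred (completion M) (\<lambda>x. f x \<in> B \<and> f x \<noteq> g x)"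
    by (rule sets_completion_AE) (use eq in auto)
  have [measurable]: "Measurable.pred (completion M) (\<lambda>x. g x \<in> B)"
    by (rule pred_sets1[OF _ gc]) simp
  have "Measurable.pred (completion M) (\<lambda>x. (f x \<in> B \<and> f x \<noteq> g x) \<or> (g x \<in> B \<and> \<not> f x \<noteq> g x))"
    by measurable
  moreover have "(f x \<in> B \<and> f x \<noteq> g x) \<or> (g x \<in> B \<and> \<not> f x \<noteq> g x) \<longleftrightarrow> f x \<in> B" for x by auto
  ultimately show "f -` B \<inter> space (completion M) \<in> sets (completion M)"
    by (simp add: pred_def vimage_def Int_def conj_commute)
qed simp

lemma completion_integral_AE_eq:
  fixes f g :: "'a \<Rightarrow> real"
  assumes g: "g \<in> borel_measurable M" and eq: "AE x in M. f x = g x"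
  shows "integrable (completion M) f \<longleftrightarrow> integrable M g"
    and "integral\<^sup>L (completion M) f = integral\<^sup>L M g"
proof -
  note f = measurable_completion_AE_eq[OF g eq] and gc = measurable_completion[OF g]
  show "integrable (completion M) f \<longleftrightarrow> integrable M g"
    using integrable_cong_AE[OF f gc AE_completion[OF eq]] integrable_completion[OF g] by simp
  show "integral\<^sup>L (completion M) f = integral\<^sup>L M g"
    using integral_cong_AE[OF f gc AE_completion[OF eq]] integral_completion[OF g] by simp
qed

section \<open>Elementary integrals evaluated at a ramp\<close>

lemma step_integral_add_scaleR:
  "step_integral m c t (w + \<epsilon> *\<^sub>R v) = step_integral m c t w + \<epsilon> * step_integral m c t v"
  by (simp add: step_integral_def apply_add apply_scaleR sum.distrib[symmetric] sum_distrib_left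
      algebra_simps)

lemma partition_range:
  assumes "partition m t" "i \<le> m"
  shows "0 \<le> t i" "t i \<le> 1"
proof -
  have mono: "t i \<le> t j" if "i \<le> j" "j \<le> m" for i j
    using that
  proof (induction j rule: dec_induct)
    case (step n)
    then have "t n \<le> t (Suc n)" using assms(1) by (simp add: partition_def)
    then show ?case using step by simp
  qed simp
  show "0 \<le> t i" "t i \<le> 1"
    using mono[of 0 i] mono[of i m] assms by (auto simp: partition_def)
qed

lemma measurable_step_integral:
  assumes "partition m t"
  shows "step_integral m c t \<in> borel_measurable (nat_filtration 1)"
  unfolding step_integral_def using partition_range[OF assms]
  by (intro borel_measurable_sum borel_measurable_times borel_measurable_const borel_measurable_diff
      measurable_eval_nat_filtration) auto

text \<open>At a ramp the elementary integral is the pairing of the step function with the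
  derivative of the ramp, computed interval by interval.\<close>

lemma step_integral_ramp:
  assumes t: "partition m t" and ab: "0 \<le> a" "a \<le> b" "b \<le> 1"
  shows "integrable lborel (\<lambda>u. indicator {0..1} u * (step_fun m c t u * indicator {a<..b} u))"
    and "step_integral m c t (ramp \<kappa> a b) =
      \<kappa> * (\<integral>u. indicator {0..1} u * (step_fun m c t u * indicator {a<..b} u) \<partial>lborel)"
proof -
  have eq: "indicator {0..1} u * (step_fun m c t u * indicator {a<..b} u) =
      (\<Sum>i<m. c i * indicator {max a (t i)<..min b (t (Suc i))} u)" for u
  proof -
    have "indicator {0..1} u * (indicator {t i<..t (Suc i)} u * indicator {a<..b} u) =
        (indicator {max a (t i)<..min b (t (Suc i))} u :: real)" for i
      using ab by (auto simp: indicator_def)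
    then show ?thesis
      by (simp only: step_fun_def sum_distrib_left sum_distrib_right mult.assoc
          mult.left_commute[of "indicator {0..1} u"])
  qed
  have int: "integrable lborel (\<lambda>u. c i * indicator {x<..y} u :: real)" for i and x y :: real
  proof -
    have "emeasure lborel {x<..y} < \<infinity>" by (cases "x \<le> y") auto
    then show ?thesis by (intro integrable_mult_right integrable_real_indicator) auto
  qed
  show "integrable lborel (\<lambda>u. indicator {0..1} u * (step_fun m c t u * indicator {a<..b} u))"
    unfolding eq by (intro Bochner_Integration.integrable_sum int)
  have "(\<integral>u. indicator {0..1} u * (step_fun m c t u * indicator {a<..b} u) \<partial>lborel) =
      (\<Sum>i<m. c i * measure lborel {max a (t i)<..min b (t (Suc i))})"
    unfolding eq by (subst Bochner_Integration.integral_sum[OF int]) simp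
  also have "\<kappa> * \<dots> = step_integral m c t (ramp \<kappa> a b)"
    unfolding step_integral_def sum_distrib_left
  proof (rule sum.cong[OF refl])
    fix i assume "i \<in> {..<m}"
    then have "t i \<le> t (Suc i)" using t by (simp add: partition_def)
    \<comment> \<open>The nested form also covers an interval disjoint from the ramp, where both
      sides are 0.\<close>
    then have M: "measure lborel {max a (t i)<..min b (t (Suc i))} =
        max a (min (t (Suc i)) b) - max a (min (t i) b)"
      using ab by (auto simp: max_def min_def)
    show "\<kappa> * (c i * measure lborel {max a (t i)<..min b (t (Suc i))}) =
        c i * (apply_bcontfun (ramp \<kappa> a b) (t (Suc i)) - apply_bcontfun (ramp \<kappa> a b) (t i))"
      unfolding M by (simp add: apply_ramp[OF ab] algebra_simps)
  qed
  finally show "step_integral m c t (ramp \<kappa> a b) =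
      \<kappa> * (\<integral>u. indicator {0..1} u * (step_fun m c t u * indicator {a<..b} u) \<partial>lborel)" ..
qed

text \<open>Pairing with a ramp is continuous in mean square, so the approximations of the
  derivative of \<open>h\<close> may be replaced by their limit. This identifies the coefficient of
  \<open>X\<close> in the decomposition of \<open>[h]\<close>.\<close>

lemma step_integral_ramp_tendsto:
  assumes h: "h \<in> cameron_martin" and ab: "0 \<le> a" "a \<le> b" "b \<le> 1"
    and t: "\<And>n::nat. partition (m n) (t n)"
    and lim: "(\<lambda>n. \<integral>\<^sup>+u. ennreal ((step_fun (m n) (c n) (t n) u - deriv (apply_bcontfun h) u)\<^sup>2)
               * indicator {0..1} u \<partial>lborel) \<longlonglongrightarrow> 0"
  shows "(\<lambda>n. step_integral (m n) (c n) (t n) (ramp \<kappa> a b)) \<longlonglongrightarrow> cm_inner h (ramp \<kappa> a b)"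
proof -
  define h' where "h' = deriv (apply_bcontfun h)"
  let ?I = "indicator {0..1} :: real \<Rightarrow> real" and ?J = "indicator {a<..b} :: real \<Rightarrow> real"
  let ?s = "\<lambda>n. step_fun (m n) (c n) (t n)"
  have h'_meas [measurable]: "(\<lambda>u. ?I u * h' u) \<in> borel_measurable lborel"
    and h'_sq: "integrable lborel (\<lambda>u. ?I u * (h' u)\<^sup>2)"
    using h by (auto simp: cameron_martin_def h'_def set_borel_measurable_def set_integrable_def)
  have h'_int: "integrable lborel (\<lambda>u. ?I u * (h' u * ?J u))"
  proof (rule Bochner_Integration.integrable_bound)
    have "integrable lborel ?I" by (rule integrable_real_indicator) auto
    then show "integrable lborel (\<lambda>u. ?I u + ?I u * (h' u)\<^sup>2)"
      using h'_sq by (rule Bochner_Integration.integrable_add)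
    have "(\<lambda>u. (?I u * h' u) * ?J u) \<in> borel_measurable lborel" by measurable
    then show "(\<lambda>u. ?I u * (h' u * ?J u)) \<in> borel_measurable lborel" by (simp add: mult.assoc)
    \<comment> \<open>Square integrability gives integrability here because the time interval is
      bounded.\<close>
    have "\<bar>x\<bar> \<le> 1 + x\<^sup>2" for x :: real
      using sum_squares_bound[of "\<bar>x\<bar>" 1] by (simp add: power2_eq_square)
    then show "AE u in lborel. norm (?I u * (h' u * ?J u)) \<le> norm (?I u + ?I u * (h' u)\<^sup>2)"
      by (intro AE_I2) (auto simp: indicator_def abs_mult)
  qed
  define g where "g n u = ?I u * ?s n u - ?I u * h' u" for n u
  have s_meas [measurable]: "?s n \<in> borel_measurable lborel" for n
    unfolding step_fun_def by measurable
  have g_meas [measurable]: "g n \<in> borel_measurable lborel" for n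
    unfolding g_def by measurable
  define E where "E n = (\<integral>\<^sup>+u. ennreal ((g n u)\<^sup>2) \<partial>lborel)" for n
  have E: "E n = (\<integral>\<^sup>+u. ennreal ((?s n u - h' u)\<^sup>2) * indicator {0..1} u \<partial>lborel)" for n
    unfolding E_def by (rule nn_integral_cong) (auto simp: g_def indicator_def)
  have diff: "(\<integral>u. ?I u * (?s n u * ?J u) \<partial>lborel) - (\<integral>u. ?I u * (h' u * ?J u) \<partial>lborel) =
      (\<integral>u. g n u * ?J u \<partial>lborel)" and g_int: "integrable lborel (\<lambda>u. g n u * ?J u)" for n
  proof -
    have eq: "?I u * (?s n u * ?J u) - ?I u * (h' u * ?J u) = g n u * ?J u" for u
      by (simp add: g_def algebra_simps)
    note s_int = step_integral_ramp(1)[OF t[of n] ab, of "c n"]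
    show "integrable lborel (\<lambda>u. g n u * ?J u)"
      using Bochner_Integration.integrable_diff[OF s_int h'_int] by (simp only: eq)
    show "(\<integral>u. ?I u * (?s n u * ?J u) \<partial>lborel) - (\<integral>u. ?I u * (h' u * ?J u) \<partial>lborel) =
        (\<integral>u. g n u * ?J u \<partial>lborel)"
      using Bochner_Integration.integral_diff[OF s_int h'_int] by (simp only: eq)
  qed
  \<comment> \<open>\<open>g n\<close> vanishes outside the unit interval; Cauchy-Schwarz is applied
    against its indicator, whose square has integral 1.\<close>
  have bound: "ennreal ((\<integral>u. g n u * ?J u \<partial>lborel)\<^sup>2) \<le> E n" for n
  proof -
    have "ennreal \<bar>\<integral>u. g n u * ?J u \<partial>lborel\<bar> \<le> (\<integral>\<^sup>+u. ennreal (norm (g n u * ?J u)) \<partial>lborel)"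
      using integral_norm_bound_ennreal[OF g_int] by simp
    also have "\<dots> \<le> (\<integral>\<^sup>+u. ennreal \<bar>g n u\<bar> * indicator {0..1} u \<partial>lborel)"
      by (rule nn_integral_mono) (auto simp: g_def indicator_def)
    finally have "(ennreal \<bar>\<integral>u. g n u * ?J u \<partial>lborel\<bar>)\<^sup>2 \<le>
        (\<integral>\<^sup>+u. ennreal \<bar>g n u\<bar> * indicator {0..1} u \<partial>lborel)\<^sup>2"
      by (rule power_mono) simp
    also have "\<dots> \<le> (\<integral>\<^sup>+u. ennreal \<bar>g n u\<bar> ^ 2 \<partial>lborel) * (\<integral>\<^sup>+u. indicator {0..1::real} u ^ 2 \<partial>lborel)"
      by (rule Cauchy_Schwarz_nn_integral) measurable
    also have "(\<integral>\<^sup>+u. indicator {0..1::real} u ^ 2 \<partial>lborel) = (\<integral>\<^sup>+u. indicator {0..1::real} u \<partial>lborel)"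
      by (rule nn_integral_cong) (auto simp: indicator_def)
    also have "\<dots> = 1" by simp
    also have "(\<integral>\<^sup>+u. ennreal \<bar>g n u\<bar> ^ 2 \<partial>lborel) = E n"
      by (simp add: E_def ennreal_power)
    finally show ?thesis by (simp add: ennreal_power)
  qed
  have "E \<longlonglongrightarrow> 0" using lim unfolding E[abs_def] h'_def .
  then have "(\<lambda>n. ennreal ((\<integral>u. g n u * ?J u \<partial>lborel)\<^sup>2)) \<longlonglongrightarrow> 0"
    by (rule tendsto_sandwich[OF _ _ tendsto_const, rotated 2]) (simp_all add: bound)
  then have "(\<lambda>n. (\<integral>u. g n u * ?J u \<partial>lborel)\<^sup>2) \<longlonglongrightarrow> 0"
    using tendsto_ennrealD[of "\<lambda>n. (\<integral>u. g n u * ?J u \<partial>lborel)\<^sup>2" 0 sequentially] by simp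
  then have "(\<lambda>n. \<integral>u. g n u * ?J u \<partial>lborel) \<longlonglongrightarrow> 0"
    by (rule tendsto_zero_if_square)
  then have "(\<lambda>n. (\<integral>u. ?I u * (?s n u * ?J u) \<partial>lborel)) \<longlonglongrightarrow> (\<integral>u. ?I u * (h' u * ?J u) \<partial>lborel)"
    unfolding diff[symmetric] by (rule LIM_zero_cancel)
  from tendsto_mult_left[OF this, of \<kappa>] show ?thesis
    by (simp add: step_integral_ramp(2)[OF t ab] cm_inner_ramp[OF ab] set_lebesgue_integral_def h'_def)
qed

section \<open>Duality\<close>

context haar_direction
begin

text \<open>By linearity \<open>S n (T w) = S n w - X w * S n \<sigma>\<close>. Along a subsequence
  \<open>S n w\<close> converges almost surely to \<open>Y w\<close>, and
  \<open>S n \<sigma>\<close> converges to the inner product; so the elementary integrals converge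
  at \<open>T w\<close> as well, although \<open>T w\<close> ranges over a null set.\<close>

lemma wiener_integral_decomposition:
  assumes h: "h \<in> cameron_martin" and Y: "is_wiener_integral \<gamma> h Y"
  obtains V where "V \<in> borel_measurable N" "AE w in \<gamma>. Y w = V (T w) + cm_inner h \<sigma> * X w"
proof -
  obtain m c t where part: "\<And>n::nat. partition (m n) (t n)"
    and lim_h: "(\<lambda>n. \<integral>\<^sup>+u. ennreal ((step_fun (m n) (c n) (t n) u - deriv (apply_bcontfun h) u)\<^sup>2)
               * indicator {0..1} u \<partial>lborel) \<longlonglongrightarrow> 0"
    and lim_Y: "(\<lambda>n. \<integral>\<^sup>+w. ennreal ((step_integral (m n) (c n) (t n) w - Y w)\<^sup>2) \<partial>completion \<gamma>)
          \<longlonglongrightarrow> 0"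
    using Y unfolding is_wiener_integral_def by blast
  define S where "S n = step_integral (m n) (c n) (t n)" for n
  have S [measurable]: "S n \<in> borel_measurable N" for n
    unfolding S_def by (rule measurable_step_integral[OF part])
  have "S n \<in> borel_measurable (completion \<gamma>)" for n
    by (rule measurable_completion[OF measurable_compose[OF measurable_id S]])
  moreover have "Y \<in> borel_measurable (completion \<gamma>)"
    using Y by (simp add: is_wiener_integral_def)
  ultimately have meas: "(\<lambda>w. S n w - Y w) \<in> borel_measurable (completion \<gamma>)" for n
    by (rule borel_measurable_diff)
  obtain r :: "nat \<Rightarrow> nat" where r: "strict_mono r"
    and lim: "AE w in completion \<gamma>. (\<lambda>n. S (r n) w - Y w) \<longlonglongrightarrow> 0"
    using L2_convergent_AE_subseq[OF meas lim_Y[folded S_def]] by blast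
  have ab': "a \<le> b" using ab by simp
  have "(\<lambda>n. S n \<sigma>) \<longlonglongrightarrow> cm_inner h \<sigma>"
    unfolding S_def by (rule step_integral_ramp_tendsto[OF h ab(1) ab' ab(3) part lim_h])
  from LIMSEQ_subseq_LIMSEQ[OF this r] have lim_\<sigma>: "(\<lambda>n. S (r n) \<sigma>) \<longlonglongrightarrow> cm_inner h \<sigma>"
    by (simp add: comp_def)
  \<comment> \<open>Without convergence \<open>lim\<close> has an unspecified value; only its values
    at \<open>T w\<close> for almost every \<open>w\<close> matter.\<close>
  define V where "V v = lim (\<lambda>n. S (r n) v)" for v
  show ?thesis
  proof (rule that)
    show "V \<in> borel_measurable N" unfolding V_def by measurable
    show "AE w in \<gamma>. Y w = V (T w) + cm_inner h \<sigma> * X w"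
      using lim[unfolded AE_completion_iff]
    proof eventually_elim
      case (elim w)
      have "S n (T w) = S n w - X w * S n \<sigma>" for n
        unfolding T_def S_def step_integral_add_scaleR by simp
      moreover have "(\<lambda>n. S (r n) w - X w * S (r n) \<sigma>) \<longlonglongrightarrow> Y w - X w * cm_inner h \<sigma>"
        by (intro tendsto_intros lim_\<sigma> LIM_zero_cancel[OF elim])
      ultimately have "V (T w) = Y w - X w * cm_inner h \<sigma>"
        unfolding V_def by (simp add: limI)
      then show ?case by (simp add: mult.commute)
    qed
  qed
qed

lemma filtration_invariant_T:
  fixes f :: "path \<Rightarrow> real"
  assumes f: "f \<in> borel_measurable (nat_filtration a)" and w: "w \<in> paths"
  shows "f (T w) = f w"
proof (rule nat_filtration_determined[OF f T_in_paths[OF w] w])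
  show "apply_bcontfun (T w) u = apply_bcontfun w u" if "u \<le> a" for u
    unfolding T_def using ab that by (intro apply_add_ramp) auto
qed

text \<open>Almost surely the exponential turns \<open>X w\<close> into
  \<open>X w + \<zeta> w\<close> and leaves \<open>T w\<close> alone. In the coordinates
  \<open>T\<close> and \<open>X\<close> the duality is then the random shift formula, carried over
  to the completion because the identities hold only almost everywhere.\<close>

lemma exp_shift_duality:
  assumes I: "wiener_integrals \<gamma> I" and F: "F \<in> polyP I"
    and \<zeta>: "\<zeta> \<in> borel_measurable (nat_filtration a)"
    and G: "G \<in> borel_measurable (nat_filtration a)"
    and A: "\<And>F u. A F u = \<zeta> u * D \<sigma> F u"
  shows "AE w in \<gamma>. exp_defined \<sigma> A F w"
    and "integrable (completion \<gamma>) (\<lambda>w. exp_op A F w * G w) \<longleftrightarrow>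
      integrable (completion \<gamma>) (\<lambda>w. F w * (G w * exp (\<zeta> w * X w - (\<zeta> w)\<^sup>2 / 2)))"
    and "(\<integral>w. exp_op A F w * G w \<partial>completion \<gamma>) =
      (\<integral>w. F w * (G w * exp (\<zeta> w * X w - (\<zeta> w)\<^sup>2 / 2)) \<partial>completion \<gamma>)"
proof -
  have ab': "a \<le> b" using ab by simp
  obtain n :: nat and h \<A> c where h: "\<forall>i<n. h i \<in> cameron_martin"
    and F: "\<forall>w\<in>paths. F w = (\<Sum>\<alpha>\<in>\<A>. c \<alpha> * (\<Prod>i<n. I (h i) w ^ \<alpha> i))"
    using F unfolding poly_functionals_def by (elim CollectE exE conjE) (rule that; assumption)
  define e where "e i = cm_inner (h i) \<sigma>" for i
  have "\<forall>i. \<exists>V. i < n \<longrightarrow> V \<in> borel_measurable N \<and> (AE w in \<gamma>. I (h i) w = V (T w) + e i * X w)"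
  proof
    fix i
    show "\<exists>V. i < n \<longrightarrow> V \<in> borel_measurable N \<and> (AE w in \<gamma>. I (h i) w = V (T w) + e i * X w)"
    proof (cases "i < n")
      case True
      then have "h i \<in> cameron_martin" "is_wiener_integral \<gamma> (h i) (I (h i))"
        using h I by (auto simp: wiener_integrals_def)
      from wiener_integral_decomposition[OF this] show ?thesis
        unfolding e_def by blast
    qed simp
  qed
  from choice[OF this] obtain V where V: "\<And>i. i < n \<Longrightarrow> V i \<in> borel_measurable N"
    and V_AE: "\<And>i. i < n \<Longrightarrow> AE w in \<gamma>. I (h i) w = V i (T w) + e i * X w"
    by blast
  have dec: "AE w in \<gamma>. \<forall>i\<in>{..<n}. I (h i) w = V i (T w) + e i * X w"
    by (rule AE_finite_allI) (simp_all add: V_AE)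
  \<comment> \<open>In \<open>wiener_integrals\<close> the quantifier over \<open>\<theta>\<close>
    stands inside the almost-everywhere statement, so a single null set serves the whole line, as
    iterated derivatives require.\<close>
  have "AE w in \<gamma>. \<forall>\<epsilon>. I (h i) (w + \<epsilon> *\<^sub>R \<sigma>) = I (h i) w + \<epsilon> * e i" if "i < n" for i
  proof -
    have "AE w in \<gamma>. \<forall>\<theta>\<in>cameron_martin. I (h i) (w + \<theta>) = I (h i) w + cm_inner (h i) \<theta>"
      using I h that by (auto simp: wiener_integrals_def)
    then show ?thesis
    proof eventually_elim
      case (elim w)
      have "\<epsilon> *\<^sub>R \<sigma> \<in> cameron_martin" "cm_inner (h i) (\<epsilon> *\<^sub>R \<sigma>) = \<epsilon> * e i" for \<epsilon>
        using ab ab' by (simp_all add: scaleR_ramp ramp_in_cameron_martin cm_inner_ramp e_def)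
      then show ?case using elim by simp
    qed
  qed
  then have line: "AE w in \<gamma>. \<forall>i\<in>{..<n}. \<forall>\<epsilon>. I (h i) (w + \<epsilon> *\<^sub>R \<sigma>) = I (h i) w + \<epsilon> * e i"
    by (intro AE_finite_allI) simp_all
  have exp: "AE w in \<gamma>. exp_defined \<sigma> A F w \<and>
      exp_op A F w = (\<Sum>\<alpha>\<in>\<A>. c \<alpha> * (\<Prod>i<n. (I (h i) w + \<zeta> w * e i) ^ \<alpha> i))"
    using line AE_space
  proof eventually_elim
    case (elim w)
    then have w: "w \<in> paths" by simp
    let ?p = "\<Sum>\<alpha>\<in>\<A>. smult (c \<alpha>) (\<Prod>i<n. [:I (h i) w, e i:] ^ \<alpha> i)"
    have line_paths: "w + \<epsilon> *\<^sub>R \<sigma> \<in> paths" for \<epsilon>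
      by (intro paths_add paths_scaleR w ramp_in_paths)
    have p: "F (w + \<epsilon> *\<^sub>R \<sigma>) = poly ?p \<epsilon>" for \<epsilon>
      using elim(1)
      by (intro poly_functional_on_line[where F = F and J = "\<lambda>i. I (h i)" and w = w and \<theta> = \<sigma>]
          bspec[OF F line_paths]) blast
    have \<zeta>_line: "\<zeta> (w + \<epsilon> *\<^sub>R \<sigma>) = \<zeta> w" for \<epsilon>
      by (rule nat_filtration_determined[OF \<zeta> line_paths w]) (rule apply_add_ramp[OF ab(1) ab' ab(3)])
    show ?case
      using exp_derivation_on_line[where A = A and F = F and w = w and \<theta> = \<sigma> and \<zeta> = \<zeta>, OF A \<zeta>_line p]
      by (simp add: poly_sum poly_prod)
  qed
  then show "AE w in \<gamma>. exp_defined \<sigma> A F w"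
    by eventually_elim blast
  have a1: "a \<le> 1" using ab by simp
  have \<zeta>_N: "\<zeta> \<in> borel_measurable N" and G_N: "G \<in> borel_measurable N"
    using measurable_nat_filtration_mono[OF a1] \<zeta> G by auto
  \<comment> \<open>\<open>f\<close> is the product of \<open>F\<close> and \<open>G\<close> in the
    coordinates \<open>T\<close> and \<open>X\<close>. As \<open>\<zeta>\<close> and
    \<open>G\<close> depend on \<open>T w\<close> only, the exponential affects just the second
    coordinate.\<close>
  define f where "f p = (\<Sum>\<alpha>\<in>\<A>. c \<alpha> * (\<Prod>i<n. (V i (fst p) + e i * snd p) ^ \<alpha> i)) * G (fst p)" for p
  have f: "f \<in> borel_measurable (N \<Otimes>\<^sub>M borel)"
    unfolding f_def
    by (intro borel_measurable_times borel_measurable_sum borel_measurable_prod borel_measurable_power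
        borel_measurable_add borel_measurable_const measurable_compose[OF measurable_fst V]
        measurable_compose[OF measurable_fst G_N] measurable_snd) auto
  have T_inv: "\<zeta> (T w) = \<zeta> w" "G (T w) = G w" if "w \<in> paths" for w
    using that filtration_invariant_T \<zeta> G by auto
  have lhs: "AE w in \<gamma>. exp_op A F w * G w = f (T w, X w + \<zeta> (T w))"
    using exp dec AE_space
  proof eventually_elim
    case (elim w)
    have "(\<Prod>i<n. (I (h i) w + \<zeta> w * e i) ^ \<alpha> i) =
        (\<Prod>i<n. (V i (T w) + e i * (X w + \<zeta> w)) ^ \<alpha> i)" for \<alpha>
      using elim(2) by (intro prod.cong) (auto simp: algebra_simps)
    then show ?case
      using elim T_inv[of w] by (simp add: f_def)
  qed
  have rhs: "AE w in \<gamma>. F w * (G w * exp (\<zeta> w * X w - (\<zeta> w)\<^sup>2 / 2)) =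
      f (T w, X w) * exp (\<zeta> (T w) * X w - (\<zeta> (T w))\<^sup>2 / 2)"
    using dec AE_space
  proof eventually_elim
    case (elim w)
    have "(\<Prod>i<n. I (h i) w ^ \<alpha> i) = (\<Prod>i<n. (V i (T w) + e i * X w) ^ \<alpha> i)" for \<alpha>
      using elim(1) by (intro prod.cong) auto
    then show ?case
      using elim T_inv[of w] F by (simp add: f_def)
  qed
  note [measurable] = f measurable_compose[OF measurable_T \<zeta>_N]
  have m1: "(\<lambda>w. f (T w, X w + \<zeta> (T w))) \<in> borel_measurable \<gamma>" by measurable
  have m2: "(\<lambda>w. f (T w, X w) * exp (\<zeta> (T w) * X w - (\<zeta> (T w))\<^sup>2 / 2)) \<in> borel_measurable \<gamma>"
    by measurable
  show "integrable (completion \<gamma>) (\<lambda>w. exp_op A F w * G w) \<longleftrightarrow>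
      integrable (completion \<gamma>) (\<lambda>w. F w * (G w * exp (\<zeta> w * X w - (\<zeta> w)\<^sup>2 / 2)))"
    unfolding completion_integral_AE_eq(1)[OF m1 lhs] completion_integral_AE_eq(1)[OF m2 rhs]
    by (rule integral_random_shift(1)[OF \<zeta>_N f])
  show "(\<integral>w. exp_op A F w * G w \<partial>completion \<gamma>) =
      (\<integral>w. F w * (G w * exp (\<zeta> w * X w - (\<zeta> w)\<^sup>2 / 2)) \<partial>completion \<gamma>)"
    unfolding completion_integral_AE_eq(2)[OF m1 lhs] completion_integral_AE_eq(2)[OF m2 rhs]
    by (rule integral_random_shift(2)[OF \<zeta>_N f])
qed

end

theorem theorem4p2:
  fixes \<gamma> :: "path measure"
    and I :: "path \<Rightarrow> path \<Rightarrow> real"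
    and s :: nat
    and z :: "nat \<Rightarrow> path \<Rightarrow> real"
  assumes "wiener_measure \<gamma>"
    and "wiener_integrals \<gamma> I"
    and "\<forall>k\<in>{1..2^s}. z k \<in> borel_measurable (nat_filtration ((real k - 1) / 2^s))"
  shows
    "(\<forall>F\<in>polyPH I. \<forall>w\<in>paths.
        (\<forall>k\<in>{1..2^s}. exp_defined (sigma_path s k) (Dz s z k) (exp_chain (Dz s z) (k - 1) F) w) \<and>
        exp_chain (Dz s z) (2^s) F w = F (w + primitive (simple_process s z w))) \<and>
     (\<forall>k\<in>{1..2^s}. \<forall>F\<in>borel_measurable (nat_filtration ((real k - 1) / 2^s)). \<forall>w\<in>paths.
        exp_defined (sigma_path s k) (Dz_star I s z k) F w \<and>
        exp_op (Dz_star I s z k) F w = F w * exp_op (Dz_star I s z k) (\<lambda>_. 1) w) \<and>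
     (\<forall>w\<in>paths.
        (\<forall>k\<in>{1..2^s}. exp_defined (sigma_path s k) (Dz_star I s z k)
           (exp_chain (Dz_star I s z) (k - 1) (\<lambda>_. 1)) w) \<and>
        exp_chain (Dz_star I s z) (2^s) (\<lambda>_. 1) w =
          exp (simple_ito s z w - 1/2 * (LBINT t:{0..1}. (simple_process s z w t)\<^sup>2))) \<and>
     (\<forall>k\<in>{1..2^s}. \<forall>F\<in>polyP I. \<forall>G\<in>borel_measurable (nat_filtration ((real k - 1) / 2^s)).
        integrable \<gamma> G \<longrightarrow>
        (AE w in \<gamma>. exp_defined (sigma_path s k) (Dz s z k) F w) \<and>
        (integrable (completion \<gamma>) (\<lambda>w. exp_op (Dz s z k) F w * G w) \<longleftrightarrow>
         integrable (completion \<gamma>) (\<lambda>w. F w * exp_op (Dz_star I s z k) G w)) \<and>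
        (\<integral>w. exp_op (Dz s z k) F w * G w \<partial>completion \<gamma>) =
        (\<integral>w. F w * exp_op (Dz_star I s z k) G w \<partial>completion \<gamma>))"
proof (intro conjI ballI impI)
  note W = assms(1) and I = assms(2) and z = assms(3)
  have G_line: "G (w + \<epsilon> *\<^sub>R sigma_path s k) = G w"
    if "k \<in> {1..2^s}" "G \<in> borel_measurable (nat_filtration ((real k - 1) / 2^s))" "w \<in> paths"
    for G :: "path \<Rightarrow> real" and k w \<epsilon>
    using nat_filtration_line[OF that(2) order.refl that(1,3)] .
  {
    fix F w and k :: nat assume "F \<in> polyPH I" "w \<in> paths" "k \<in> {1..2^s}"
    then show "exp_defined (sigma_path s k) (Dz s z k) (exp_chain (Dz s z) (k - 1) F) w"
      using exp_chain_Dz_defined[OF I z] by blast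
  next
    fix F w assume "F \<in> polyPH I" "w \<in> paths"
    then show "exp_chain (Dz s z) (2^s) F w = F (w + primitive (simple_process s z w))"
      using exp_chain_Dz[OF I z, of F "2^s" w] by (simp add: primitive_simple_process)
  next
    fix k :: nat and F :: "path \<Rightarrow> real" and w
    assume k: "k \<in> {1..2^s}" and F: "F \<in> borel_measurable (nat_filtration ((real k - 1) / 2^s))"
      and w: "w \<in> paths"
    note F_line = G_line[OF k F w]
    show "exp_defined (sigma_path s k) (Dz_star I s z k) F w"
      by (rule exp_Dz_star(1)[OF I z k w F_line])
    show "exp_op (Dz_star I s z k) F w = F w * exp_op (Dz_star I s z k) (\<lambda>_. 1) w"
      using exp_Dz_star(2)[OF I z k w, of "\<lambda>_. 1"] exp_Dz_star(2)[OF I z k w F_line] by simp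
  next
    fix w and k :: nat assume "w \<in> paths" "k \<in> {1..2^s}"
    then show "exp_defined (sigma_path s k) (Dz_star I s z k)
           (exp_chain (Dz_star I s z) (k - 1) (\<lambda>_. 1)) w"
      using exp_chain_Dz_star_defined[OF I z] by blast
  next
    fix w assume "w \<in> paths"
    then show "exp_chain (Dz_star I s z) (2^s) (\<lambda>_. 1) w =
          exp (simple_ito s z w - 1/2 * (LBINT t:{0..1}. (simple_process s z w t)\<^sup>2))"
      using exp_chain_Dz_star[OF I z, of "2^s" w] log_density_eq[OF I z, of w] by simp
  next
    fix k :: nat and F G :: "path \<Rightarrow> real"
    assume k: "k \<in> {1..2^s}" and F: "F \<in> polyP I"
      and G: "G \<in> borel_measurable (nat_filtration ((real k - 1) / 2^s))"
    let ?a = "(real k - 1) / 2^s" and ?b = "real k / 2^s" and ?\<kappa> = "2 powr (real s / 2)"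
    interpret H: haar_direction \<gamma> ?a ?b ?\<kappa>
    proof
      show "?\<kappa>\<^sup>2 * (?b - ?a) = 1"
        using haar_scaling[of s] by (simp add: power2_eq_square diff_divide_distrib)
    qed (use W dyadic_bounds[OF k] in \<open>auto intro: divide_strict_right_mono\<close>)
    have zk: "z k \<in> borel_measurable (nat_filtration ?a)" by (rule bspec[OF z k])
    note dual = H.exp_shift_duality[OF I F zk G, of "Dz s z k", folded sigma_path_eq_ramp, OF Dz_def]
    show "AE w in \<gamma>. exp_defined (sigma_path s k) (Dz s z k) F w"
      by (rule dual(1))
    have "exp_op (Dz_star I s z k) G w = G w * exp (z k w * H.X w - (z k w)\<^sup>2 / 2)" if "w \<in> paths" for w
      using exp_Dz_star(2)[OF I z k that, of G, OF G_line[OF k G that]]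
      by (simp add: wiener_integral_sigma_path[OF I k that] H.X_def)
    \<comment> \<open>The adjoint exponential is known at every path, so the two integrands agree
      pointwise on the whole space.\<close>
    then have eq: "F w * exp_op (Dz_star I s z k) G w =
        F w * (G w * exp (z k w * H.X w - (z k w)\<^sup>2 / 2))" if "w \<in> space (completion \<gamma>)" for w
      using that by simp
    show "integrable (completion \<gamma>) (\<lambda>w. exp_op (Dz s z k) F w * G w) \<longleftrightarrow>
         integrable (completion \<gamma>) (\<lambda>w. F w * exp_op (Dz_star I s z k) G w)"
      unfolding dual(2) by (rule Bochner_Integration.integrable_cong[OF refl eq, symmetric])
    show "(\<integral>w. exp_op (Dz s z k) F w * G w \<partial>completion \<gamma>) =
        (\<integral>w. F w * exp_op (Dz_star I s z k) G w \<partial>completion \<gamma>)"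
      unfolding dual(3) by (rule Bochner_Integration.integral_cong[OF refl eq, symmetric])
  }
qed

end
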